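(* For every positive integer $n$, the following identity holds in $\mathbb{Q}(q,t)$: $$\frac{(1-t)^n}{(1-q)^n}\, n! = \sum_{\lambda \vdash n}\ \sum_{P, Q \in \mathrm{SYT}(\lambda)} \psi_P(q,t)\, \varphi_Q(q,t),$$ where the inner sum is over all ordered pairs $(P,Q)$ of standard Young tableaux of shape $\lambda$.
   Context: $\mathbb{Q}(q,t)$ is the field of rational functions in $q$ and $t$. A partition $\kappa$ is identified with its Young diagram, the set of cells (row $r$, column $c$) with $r \geq 1$, $1 \le c \le \kappa_r$, drawn in French notation (row 1, of length $\kappa_1$, at the bottom). For a cell $c \in \kappa$, the arm-length $a_\kappa(c)$ (resp. leg-length $\ell_\kappa(c)$) is the number of cells of $\kappa$ strictly to the right of $c$ in its row (resp. strictly above $c$ in its column). Define $$b_\kappa(c) = \frac{1 - q^{a_\kappa(c)} t^{\ell_\kappa(c)+1}}{1 - q^{a_\kappa(c)+1} t^{\ell_\kappa(c)}}.$$ For $\mu \subseteq \lambda$, let $\mathcal{R}_{\lambda/\mu}$ (resp. $\mathcal{C}_{\lambda/\mu}$) be the set of all cells of $\mu$ lying in a row (resp. column) that contains a cell of $\lambda/\mu$, and define $$\psi_{\lambda/\mu}(q,t) = \prod_{c \in \mathcal{R}_{\lambda/\mu} - \mathcal{C}_{\lambda/\mu}} \frac{b_\mu(c)}{b_\lambda(c)}, \qquad \varphi_{\lambda/\mu}(q,t) = \prod_{c \in \lambda/\mu} b_\lambda(c) \prod_{c \in \mathcal{C}_{\lambda/\mu}} \frac{b_\lambda(c)}{b_\mu(c)}.$$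 $\mathrm{SYT}(\lambda)$ is the set of standard Young tableaux of shape $\lambda$. For a tableau $T$, let $T^{(i)}$ be the shape of the subtableau of entries at most $i$ (so $T^{(0)} = \emptyset$), and define $$\psi_T(q,t) = \prod_{i \geq 1} \psi_{T^{(i)}/T^{(i-1)}}(q,t), \qquad \varphi_T(q,t) = \prod_{i \geq 1} \varphi_{T^{(i)}/T^{(i-1)}}(q,t).$$ *)

theory Defs
  imports
    "HOL-Computational_Algebra.Polynomial"
    "HOL-Computational_Algebra.Fraction_Field"
    "HOL-Library.FuncSet"
begin

text \<open>\<open>\<rat>(q, t)\<close> is the fraction field of \<open>\<rat>[q][t]\<close>: the inner polynomial variable is \<open>q\<close>,
  the outer one is \<open>t\<close>.\<close>

type_synonym ratfun_qt = "rat poly poly fract"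

definition qvar :: ratfun_qt where
  "qvar = Fract [:[:0, 1:]:] 1"

definition tvar :: ratfun_qt where
  "tvar = Fract [:0, 1:] 1"

text \<open>A partition is the list of its positive parts in weakly decreasing order.\<close>

definition partitions_of :: "nat \<Rightarrow> nat list set" where
  "partitions_of n = {lam. sorted_wrt (\<ge>) lam \<and> (\<forall>x\<in>set lam. 0 < x) \<and> sum_list lam = n}"

text \<open>Cells are pairs (row, column), both counted from 1. As partitions are identified with their
  Young diagrams, everything below takes the diagram, a set of cells, as its argument.\<close>

type_synonym cell = "nat \<times> nat"

definition young_diagram :: "nat list \<Rightarrow> cell set" where
  "young_diagram lam = {(r, c). 1 \<le> r \<and> r \<le> length lam \<and> 1 \<le> c \<and> c \<le> lam ! (r - 1)}"

definition arm :: "cell set \<Rightarrow> cell \<Rightarrow> nat" where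
  "arm kap x = card {y \<in> kap. fst y = fst x \<and> snd x < snd y}"

definition leg :: "cell set \<Rightarrow> cell \<Rightarrow> nat" where
  "leg kap x = card {y \<in> kap. snd y = snd x \<and> fst x < fst y}"

definition b_cell :: "cell set \<Rightarrow> cell \<Rightarrow> ratfun_qt" where
  "b_cell kap x = (1 - qvar ^ arm kap x * tvar ^ (leg kap x + 1)) /
                (1 - qvar ^ (arm kap x + 1) * tvar ^ leg kap x)"

definition row_cells :: "cell set \<Rightarrow> cell set \<Rightarrow> cell set" where
  "row_cells lam mu = {x \<in> mu. \<exists>y \<in> lam - mu. fst y = fst x}"

definition col_cells :: "cell set \<Rightarrow> cell set \<Rightarrow> cell set" where
  "col_cells lam mu = {x \<in> mu. \<exists>y \<in> lam - mu. snd y = snd x}"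

definition psi_skew :: "cell set \<Rightarrow> cell set \<Rightarrow> ratfun_qt" where
  "psi_skew lam mu = (\<Prod>x \<in> row_cells lam mu - col_cells lam mu. b_cell mu x / b_cell lam x)"

definition phi_skew :: "cell set \<Rightarrow> cell set \<Rightarrow> ratfun_qt" where
  "phi_skew lam mu = (\<Prod>x \<in> lam - mu. b_cell lam x) *
                  (\<Prod>x \<in> col_cells lam mu. b_cell lam x / b_cell mu x)"

text \<open>A tableau is a filling of the cells. Requiring \<open>T \<in> extensional lam\<close> fixes its irrelevant
  values outside of \<open>lam\<close>, so that each standard Young tableau occurs exactly once.\<close>

definition SYT :: "cell set \<Rightarrow> (cell \<Rightarrow> nat) set" where
  "SYT lam = {T \<in> extensional lam.
     bij_betw T lam {1..card lam} \<and>
     (\<forall>x\<in>lam. \<forall>y\<in>lam. fst x = fst y \<and> snd x < snd y \<longrightarrow> T x < T y) \<and>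
     (\<forall>x\<in>lam. \<forall>y\<in>lam. snd x = snd y \<and> fst x < fst y \<longrightarrow> T x < T y)}"

definition subshape :: "cell set \<Rightarrow> (cell \<Rightarrow> nat) \<Rightarrow> nat \<Rightarrow> cell set" where
  "subshape lam T i = {x \<in> lam. T x \<le> i}"

text \<open>The products over all \<open>i \<ge> 1\<close> stop at \<open>card lam\<close>, the largest entry of a standard tableau:
  beyond it the subshapes are constant, and the factors are 1.\<close>

definition psi_tableau :: "cell set \<Rightarrow> (cell \<Rightarrow> nat) \<Rightarrow> ratfun_qt" where
  "psi_tableau lam T = (\<Prod>i = 1..card lam. psi_skew (subshape lam T i) (subshape lam T (i - 1)))"

definition phi_tableau :: "cell set \<Rightarrow> (cell \<Rightarrow> nat) \<Rightarrow> ratfun_qt" where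
  "phi_tableau lam T = (\<Prod>i = 1..card lam. phi_skew (subshape lam T i) (subshape lam T (i - 1)))"

end

theory Submission
  imports Defs
begin

text \<open>Write \<open>A\<^sub>\<lambda>\<close> and \<open>B\<^sub>\<lambda>\<close> for the sums of \<open>\<psi>\<^sub>P\<close> and \<open>\<phi>\<^sub>Q\<close> over the standard tableaux of shape
  \<open>\<lambda>\<close>, so that the right-hand side is the sum of \<open>A\<^sub>\<lambda> B\<^sub>\<lambda>\<close>. Deleting the largest entry of a tableau
  gives \<open>A\<^sub>\<lambda> = \<Sum>\<^sub>\<mu> \<psi>\<^bsub>\<lambda>/\<mu>\<^esub> A\<^sub>\<mu>\<close> and \<open>B\<^sub>\<lambda> = \<Sum>\<^sub>\<mu> \<phi>\<^bsub>\<lambda>/\<mu>\<^esub> B\<^sub>\<mu>\<close>, summed over the shapes \<open>\<mu>\<close> that arise from \<open>\<lambda>\<close> by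
  removing one cell (\<open>tableau_sum_remove\<close>). Thus \<open>B\<close> is produced by an operator \<open>U\<close> that adds a
  cell with weight \<open>\<phi>\<close>, and \<open>A\<close> by the transpose of an operator \<open>D\<close> that removes a cell with weight
  \<open>\<psi>\<close>. As for the Robinson--Schensted correspondence and differential posets, everything follows from
  the commutation relation \<open>D U - U D = c\<close> with \<open>c = (1 - t) / (1 - q)\<close>: by induction it gives
  \<open>D B = (n + 1) c B\<close> from level \<open>n + 1\<close> to level \<open>n\<close> (\<open>tableau_sum_phi_down\<close>), and each level contributes
  one factor \<open>(n + 1) c\<close> to the sum (\<open>sum_diagrams_Suc\<close>).

  The off-diagonal part of the relation (\<open>skew_commute\<close>) is local: when two different cells are added
  in either order, the weights can only differ at the single cell where the row of one meets
  the column of the other, and there the two discrepancies cancel.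

  The diagonal part (\<open>skew_weight_commutator\<close>) is a residue computation. Put \<open>y\<^sub>j = q\<^bsup>\<mu>(j)\<^esup> / t\<^bsup>j\<^esup>\<close> for
  the rows of \<open>\<mu>\<close>, and let \<open>N\<close> be at least the number of rows. Up to the constant \<open>c\<close> and simple factors,
  \<open>\<psi> \<phi>\<close> for adding a cell to row \<open>r\<close> is the residue at \<open>z = q y\<^sub>r\<close> of \<open>f(z) / z\<close>, where

    \<open>f(z) = \<Prod>\<^bsub>j \<le> N+1\<^esub> (z - t y\<^sub>j) / (z - q y\<^sub>j) \<cdot> \<Prod>\<^bsub>k \<le> N\<^esub> (z - (q/t) y\<^sub>k) / (z - y\<^sub>k)\<close>,

  and \<open>\<psi> \<phi>\<close> for removing a cell from row \<open>r\<close> is the residue at \<open>z = y\<^sub>r\<close>. A row to which no cell can be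
  added, or from which none can be removed, needs no separate treatment, since a factor of the
  numerator vanishes there. The relation says that the residues at finite points add up to \<open>f(\<infinity>) = 1\<close>.\<close>

section \<open>Monomials in q and t\<close>

lemma qt_monom: "qvar ^ a * tvar ^ b = Fract (monom (monom 1 a) b) 1"
proof -
  have q: "qvar ^ a = Fract (monom (monom 1 a) 0) 1" for a
  proof (induction a)
    case 0
    then show ?case by (simp add: One_fract_def)
  next
    case (Suc a)
    have "qvar ^ Suc a = Fract ([:[:0,1:]:] * monom (monom 1 a) 0) 1"
      by (simp only: power_Suc Suc.IH) (simp add: qvar_def)
    also have "[:[:0,1:]:] * monom (monom 1 a) 0 = monom (monom (1::rat) (Suc a)) 0"
      by (simp add: monom_0 monom_Suc)
    finally show ?case .
  qed
  have t: "tvar ^ b = Fract (monom 1 b) 1" for b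
  proof (induction b)
    case 0
    then show ?case by (simp add: One_fract_def)
  next
    case (Suc b)
    have "tvar ^ Suc b = Fract ([:0,1:] * monom 1 b) 1"
      by (simp only: power_Suc Suc.IH) (simp add: tvar_def)
    also have "[:0,1:] * monom 1 b = monom (1 :: rat poly) (Suc b)"
      by (simp add: monom_Suc)
    finally show ?case .
  qed
  show ?thesis by (simp add: q t mult_monom)
qed

lemma qt_monomial_inject:
  "qvar ^ a * tvar ^ b = qvar ^ c * tvar ^ d \<longleftrightarrow> a = c \<and> b = d"
proof
  assume "qvar ^ a * tvar ^ b = qvar ^ c * tvar ^ d"
  then have eq: "monom (monom (1::rat) a) b = monom (monom 1 c) d"
    by (simp add: qt_monom eq_fract)
  have "b = d"
    using arg_cong[OF eq, of degree] by (simp add: degree_monom_eq)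
  moreover have "a = c"
    using arg_cong[OF eq, of "\<lambda>p. degree (coeff p b)"] \<open>b = d\<close> by (simp add: degree_monom_eq)
  ultimately show "a = c \<and> b = d" by simp
qed simp

lemma q_nonzero [simp]: "qvar \<noteq> 0" and t_nonzero [simp]: "tvar \<noteq> 0"
  by (simp_all add: qvar_def tvar_def Zero_fract_def eq_fract)

lemma qt_monomial_eq_1: "qvar ^ a * tvar ^ b = 1 \<longleftrightarrow> a = 0 \<and> b = 0"
  using qt_monomial_inject[of a b 0 0] by simp

lemma q_neq_1 [simp]: "1 - qvar \<noteq> 0"
  using qt_monomial_eq_1[of 1 0] by auto

text \<open>The value of \<open>b\<^sub>\<kappa>\<close> at a cell of arm-length \<open>a\<close> and leg-length \<open>l\<close>. All denominators are nonzero because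
  \<open>q\<close> and \<open>t\<close> satisfy no monomial relation.\<close>
definition b_val :: "nat \<Rightarrow> nat \<Rightarrow> ratfun_qt" where
  "b_val a l = (1 - qvar ^ a * tvar ^ (l + 1)) / (1 - qvar ^ (a + 1) * tvar ^ l)"

lemma b_val_denom: "1 - qvar ^ (a + 1) * tvar ^ l \<noteq> 0" "1 - qvar ^ a * tvar ^ (l + 1) \<noteq> 0"
  using qt_monomial_eq_1[of "a+1" l] qt_monomial_eq_1[of a "l+1"] by auto

lemma b_val_nonzero [simp]: "b_val a l \<noteq> 0"
  using b_val_denom[of a l] by (simp add: b_val_def)

lemma b_cell_eq: "b_cell S z = b_val (arm S z) (leg S z)"
  by (simp add: b_cell_def b_val_def)

lemma b_cell_nonzero [simp]: "b_cell S z \<noteq> 0"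
  by (simp add: b_cell_eq)

section \<open>Young diagrams and their one-cell extensions\<close>

text \<open>The Young diagrams of partitions, characterised intrinsically so that unions, intersections and
  the removal of a cell need no reference to a list of parts.\<close>
definition diagram :: "cell set \<Rightarrow> bool" where
  "diagram S \<longleftrightarrow> finite S \<and> (\<forall>r c. (r, c) \<in> S \<longrightarrow> 1 \<le> r \<and> 1 \<le> c) \<and>
    (\<forall>r c r' c'. (r, c) \<in> S \<longrightarrow> 1 \<le> r' \<longrightarrow> r' \<le> r \<longrightarrow> 1 \<le> c' \<longrightarrow> c' \<le> c \<longrightarrow> (r', c') \<in> S)"

definition addable :: "cell set \<Rightarrow> cell set" where
  "addable S = {x. x \<notin> S \<and> diagram (insert x S)}"

definition removable :: "cell set \<Rightarrow> cell set" where
  "removable S = {x \<in> S. diagram (S - {x})}"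

lemma diagram_finite: "diagram S \<Longrightarrow> finite S"
  by (simp add: diagram_def)

lemma diagram_ge_1: "diagram S \<Longrightarrow> (r, c) \<in> S \<Longrightarrow> 1 \<le> r \<and> 1 \<le> c"
  unfolding diagram_def by blast

lemma diagram_down:
  "diagram S \<Longrightarrow> (r, c) \<in> S \<Longrightarrow> 1 \<le> r' \<Longrightarrow> r' \<le> r \<Longrightarrow> 1 \<le> c' \<Longrightarrow> c' \<le> c \<Longrightarrow> (r', c') \<in> S"
  unfolding diagram_def by blast

lemma diagram_Un: "diagram S \<Longrightarrow> diagram T \<Longrightarrow> diagram (S \<union> T)"
  unfolding diagram_def by (metis UnE UnI1 UnI2 finite_UnI)

lemma diagram_Int: "diagram S \<Longrightarrow> diagram T \<Longrightarrow> diagram (S \<inter> T)"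
  unfolding diagram_def by (metis IntE IntI finite_Int)

lemma diagram_empty: "diagram {}" by (simp add: diagram_def)

section \<open>Commutation of two different cells\<close>

lemma addable_row_neq:
  assumes "x \<in> addable S" "y \<in> addable S" "x \<noteq> y"
  shows "fst x \<noteq> fst y"
proof
  have *: "\<not> c < d" if "(r, c) \<in> addable S" "(r, d) \<in> addable S" for r c d
  proof
    assume "c < d"
    have x: "diagram (insert (r, c) S)" "(r, c) \<notin> S" and y: "diagram (insert (r, d) S)"
      using that by (auto simp: addable_def)
    have "1 \<le> r \<and> 1 \<le> c" using diagram_ge_1[OF x(1), of r c] by simp
    then have "(r, c) \<in> insert (r, d) S"
      using \<open>c < d\<close> diagram_down[OF y, of r d r c] by simp
    with x \<open>c < d\<close> show False by simp
  qed
  assume "fst x = fst y"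
  with assms(3) have "snd x \<noteq> snd y" by (simp add: prod_eq_iff)
  with *[of "fst x" "snd x" "snd y"] *[of "fst x" "snd y" "snd x"] assms(1,2) \<open>fst x = fst y\<close>
  show False by (metis linorder_neqE_nat prod.collapse)
qed

lemma addable_col_neq:
  assumes "x \<in> addable S" "y \<in> addable S" "x \<noteq> y"
  shows "snd x \<noteq> snd y"
proof
  have *: "\<not> r < s" if "(r, c) \<in> addable S" "(s, c) \<in> addable S" for r s c
  proof
    assume "r < s"
    have x: "diagram (insert (r, c) S)" "(r, c) \<notin> S" and y: "diagram (insert (s, c) S)"
      using that by (auto simp: addable_def)
    have "1 \<le> r \<and> 1 \<le> c" using diagram_ge_1[OF x(1), of r c] by simp
    then have "(r, c) \<in> insert (s, c) S"
      using \<open>r < s\<close> diagram_down[OF y, of s c r c] by simp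
    with x \<open>r < s\<close> show False by simp
  qed
  assume "snd x = snd y"
  with assms(3) have "fst x \<noteq> fst y" by (simp add: prod_eq_iff)
  with *[of "fst x" "snd x" "fst y"] *[of "fst y" "snd x" "fst x"] assms(1,2) \<open>snd x = snd y\<close>
  show False by (metis linorder_neqE_nat prod.collapse)
qed

lemma arm_insert_other: "fst z \<noteq> fst x \<Longrightarrow> arm (insert x S) z = arm S z"
  unfolding arm_def by (rule arg_cong[where f = card]) auto

lemma leg_insert_other: "snd z \<noteq> snd x \<Longrightarrow> leg (insert x S) z = leg S z"
  unfolding leg_def by (rule arg_cong[where f = card]) auto

lemma b_cell_insert_other:
  "fst z \<noteq> fst x \<Longrightarrow> snd z \<noteq> snd x \<Longrightarrow> b_cell (insert x S) z = b_cell S z"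
  by (simp add: b_cell_eq arm_insert_other leg_insert_other)

text \<open>A cell of \<open>S\<close> cannot be both in the row and in the column of a new cell, so when a single cell is
  added, \<open>\<psi>\<close> is a product over a full row and \<open>\<phi>\<close> over a full column.\<close>
lemma psi_skew_insert:
  assumes "x \<notin> S"
  shows "psi_skew (insert x S) S = (\<Prod>z\<in>{z\<in>S. fst z = fst x}. b_cell S z / b_cell (insert x S) z)"
proof -
  have "row_cells (insert x S) S - col_cells (insert x S) S = {z\<in>S. fst z = fst x}"
    using assms by (auto simp: row_cells_def col_cells_def prod_eq_iff)
  then show ?thesis by (simp add: psi_skew_def)
qed

lemma phi_skew_insert:
  assumes "x \<notin> S"
  shows "phi_skew (insert x S) S = b_cell (insert x S) x *
    (\<Prod>z\<in>{z\<in>S. snd z = snd x}. b_cell (insert x S) z / b_cell S z)"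
proof -
  have "col_cells (insert x S) S = {z\<in>S. snd z = snd x}"
    using assms by (auto simp: col_cells_def)
  moreover have "insert x S - S = {x}" using assms by auto
  ultimately show ?thesis by (simp add: phi_skew_def)
qed

text \<open>Every cell outside the row of \<open>x\<close> and the column of \<open>y\<close> enters neither side. For the others let \<open>g\<close>
  be the mixed ratio of the four values of \<open>b\<close>. Passing from the right-hand side to the left-hand side multiplies
  \<open>\<psi>\<close> by \<open>1/g\<close> over the row of \<open>x\<close> and \<open>\<phi>\<close> by \<open>g\<close> over the column of \<open>y\<close>; as \<open>g\<close> is 1 at a cell that is
  aligned with only one of \<open>x\<close> and \<open>y\<close>, both products reduce to the crossing of that row and column.\<close>
lemma skew_commute:
  assumes S: "diagram S" and x: "x \<in> addable S" and y: "y \<in> addable S" and "x \<noteq> y"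
  shows "psi_skew (insert x (insert y S)) (insert y S) * phi_skew (insert x (insert y S)) (insert x S)
       = psi_skew (insert x S) S * phi_skew (insert y S) S"
proof -
  have fin: "finite S" using S by (rule diagram_finite)
  have rn: "fst x \<noteq> fst y" and cn: "snd x \<noteq> snd y"
    using addable_row_neq[OF x y] addable_col_neq[OF x y] assms(4) by auto
  have xS: "x \<notin> S" "y \<notin> S" using x y by (auto simp: addable_def)
  define g where "g z = b_cell (insert x (insert y S)) z * b_cell S z /
                        (b_cell (insert x S) z * b_cell (insert y S) z)" for z
  define R where "R = {z\<in>S. fst z = fst x}"
  define C where "C = {z\<in>S. snd z = snd y}"
  have g1: "g z = 1" if "fst z \<noteq> fst x" "snd z \<noteq> snd x" for z
    using that by (simp add: g_def b_cell_insert_other)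
  have g2: "g z = 1" if "fst z \<noteq> fst y" "snd z \<noteq> snd y" for z
    using that by (simp add: g_def b_cell_insert_other insert_commute[of x y])
  have R: "{z \<in> insert y S. fst z = fst x} = R" and C: "{z \<in> insert x S. snd z = snd y} = C"
    using rn cn by (auto simp: R_def C_def)
  have RC: "prod g R = prod g (R \<inter> C)"
    using fin rn by (intro prod.mono_neutral_right) (auto intro!: g2 simp: R_def C_def)
  have CR: "prod g C = prod g (R \<inter> C)"
    using fin cn by (intro prod.mono_neutral_right) (auto intro!: g1 simp: R_def C_def)
  have "psi_skew (insert x (insert y S)) (insert y S) =
      (\<Prod>z\<in>R. b_cell (insert y S) z / b_cell (insert x (insert y S)) z)"
    using xS \<open>x \<noteq> y\<close> psi_skew_insert[of x "insert y S", unfolded R] by simp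
  moreover have "psi_skew (insert x S) S = (\<Prod>z\<in>R. b_cell S z / b_cell (insert x S) z)"
    using xS by (simp add: psi_skew_insert R_def)
  ultimately have psi: "psi_skew (insert x (insert y S)) (insert y S) * prod g R = psi_skew (insert x S) S"
    by (simp add: g_def prod.distrib[symmetric] field_simps)
  have yb: "b_cell (insert y (insert x S)) y = b_cell (insert y S) y"
    using rn cn by (simp add: insert_commute[of y x] b_cell_insert_other)
  have "phi_skew (insert y (insert x S)) (insert x S) = b_cell (insert y S) y *
      (\<Prod>z\<in>C. b_cell (insert y (insert x S)) z / b_cell (insert x S) z)"
    using xS \<open>x \<noteq> y\<close> phi_skew_insert[of y "insert x S", unfolded C yb] by simp
  moreover have "phi_skew (insert y S) S = b_cell (insert y S) y *
      (\<Prod>z\<in>C. b_cell (insert y S) z / b_cell S z)"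
    using xS by (simp add: phi_skew_insert C_def)
  ultimately have phi: "phi_skew (insert x (insert y S)) (insert x S) = phi_skew (insert y S) S * prod g C"
    by (simp add: g_def prod.distrib[symmetric] insert_commute[of x y] mult.assoc)
  show ?thesis using psi phi RC CR by (simp add: mult_ac)
qed

section \<open>Removing the largest entry of a tableau\<close>

text \<open>The same recursion serves \<open>\<psi>\<close> and \<open>\<phi>\<close>, so the weight \<open>w\<close> of a one-cell step is left arbitrary.\<close>
definition tableau_sum :: "(cell set \<Rightarrow> cell set \<Rightarrow> ratfun_qt) \<Rightarrow> cell set \<Rightarrow> ratfun_qt" where
  "tableau_sum w S = (\<Sum>T\<in>SYT S. \<Prod>i = 1..card S. w (subshape S T i) (subshape S T (i - 1)))"

lemma finite_SYT: "finite S \<Longrightarrow> finite (SYT S)"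
  by (rule finite_subset[of _ "S \<rightarrow>\<^sub>E {1..card S}"])
    (auto simp: SYT_def PiE_def bij_betw_def intro: finite_PiE[unfolded PiE_def])

lemma finite_removable: "finite S \<Longrightarrow> finite (removable S)"
  by (simp add: removable_def)

lemma SYT_le: "T \<in> SYT S \<Longrightarrow> z \<in> S \<Longrightarrow> T z \<le> card S"
  using bij_betwE[of T S "{1..card S}"] by (auto simp: SYT_def)

lemma SYT_row: "T \<in> SYT S \<Longrightarrow> (r, c) \<in> S \<Longrightarrow> (r, c') \<in> S \<Longrightarrow> c < c' \<Longrightarrow> T (r, c) < T (r, c')"
  by (auto simp: SYT_def)

lemma SYT_col: "T \<in> SYT S \<Longrightarrow> (r, c) \<in> S \<Longrightarrow> (r', c) \<in> S \<Longrightarrow> r < r' \<Longrightarrow> T (r, c) < T (r', c)"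
  by (auto simp: SYT_def)

lemma SYT_extend:
  assumes S: "diagram S" and x: "x \<in> removable S" and T: "T \<in> SYT (S - {x})"
  shows "T(x := card S) \<in> SYT S"
proof -
  let ?T = "T(x := card S)"
  have fin: "finite S" and xS: "x \<in> S" and D: "diagram (S - {x})"
    using S x by (auto simp: removable_def diagram_finite)
  obtain n where n: "card S = Suc n" "card (S - {x}) = n"
    using fin xS by (metis card.remove)
  have lt: "T z < card S" if "z \<in> S" "z \<noteq> x" for z
    using SYT_le[OF T, of z] that n by simp
  \<comment> \<open>No cell of S lies to the right of x or above it, so the largest entry may be put into x.\<close>
  have last: False if "z \<in> S" "fst x = fst z \<and> snd x < snd z \<or> snd x = snd z \<and> fst x < fst z" for z
  proof -
    have "(fst z, snd z) \<in> S - {x}" using that by auto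
    moreover have "1 \<le> fst x \<and> 1 \<le> snd x" using diagram_ge_1[OF S, of "fst x" "snd x"] xS by simp
    ultimately have "(fst x, snd x) \<in> S - {x}"
      using that(2) diagram_down[OF D, of "fst z" "snd z" "fst x" "snd x"] by auto
    then show False by simp
  qed
  have "bij_betw T (S - {x}) {1..n}" using T n by (simp add: SYT_def)
  then have "bij_betw ?T (S - {x}) {1..n}"
    by (rule bij_betw_cong[THEN iffD1, rotated]) auto
  then have "bij_betw ?T ((S - {x}) \<union> {x}) ({1..n} \<union> {Suc n})"
    by (rule bij_betw_combine) (auto simp: n bij_betw_def)
  moreover have "(S - {x}) \<union> {x} = S" "{1..n} \<union> {Suc n} = {1..card S}"
    using xS n by auto
  ultimately have "bij_betw ?T S {1..card S}" by simp
  moreover have "?T \<in> extensional S"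
    using T xS by (auto simp: SYT_def extensional_def)
  moreover have "?T y < ?T z"
    if yz: "y \<in> S" "z \<in> S" "fst y = fst z \<and> snd y < snd z \<or> snd y = snd z \<and> fst y < fst z" for y z
  proof -
    have "y \<noteq> x" using last[of z] yz by auto
    show ?thesis
    proof (cases "z = x")
      case True
      then show ?thesis using lt[of y] yz \<open>y \<noteq> x\<close> by simp
    next
      case False
      then show ?thesis using T yz \<open>y \<noteq> x\<close> by (auto simp: SYT_def)
    qed
  qed
  ultimately show ?thesis by (simp add: SYT_def)
qed

lemma SYT_remove:
  assumes S: "diagram S" and T: "T \<in> SYT S" and x: "x \<in> S" "T x = card S"
  shows "x \<in> removable S" "restrict T (S - {x}) \<in> SYT (S - {x})"
proof -
  have fin: "finite S" using S by (rule diagram_finite)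
  obtain n where n: "card S = Suc n" "card (S - {x}) = n"
    using fin x by (metis card.remove)
  have bij: "bij_betw T S {1..card S}" using T by (simp add: SYT_def)
  \<comment> \<open>Entries increase along rows and columns, so x, having the largest entry, supports no other cell.\<close>
  have neq: "(r', c') \<noteq> x"
    if "(r, c) \<in> S - {x}" "1 \<le> r'" "r' \<le> r" "1 \<le> c'" "c' \<le> c" for r c r' c'
  proof
    assume eq: "(r', c') = x"
    have mem: "(r, c) \<in> S" "(r', c) \<in> S" "(r', c') \<in> S"
      using that diagram_down[OF S, of r c r' c] diagram_down[OF S, of r c r' c'] by auto
    have "T (r', c') \<le> T (r', c)" "T (r', c) \<le> T (r, c)"
      using SYT_row[OF T mem(3,2)] SYT_col[OF T mem(2,1)] that(3,5) by (auto simp: le_less)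
    moreover have "T (r, c) \<noteq> T x" using inj_onD[OF bij_betw_imp_inj_on[OF bij]] that(1) x(1) by blast
    ultimately show False using SYT_le[OF T mem(1)] x(2) eq by simp
  qed
  have "diagram (S - {x})"
    unfolding diagram_def
  proof (intro conjI allI impI)
    show "finite (S - {x})" using fin by simp
  next
    fix r c assume "(r, c) \<in> S - {x}"
    then show "1 \<le> r" "1 \<le> c" using diagram_ge_1[OF S, of r c] by auto
  next
    fix r c r' c'
    assume a: "(r, c) \<in> S - {x}" "1 \<le> r'" "r' \<le> r" "1 \<le> c'" "c' \<le> c"
    then show "(r', c') \<in> S - {x}" using neq[OF a] diagram_down[OF S, of r c r' c'] by auto
  qed
  then show "x \<in> removable S" using x by (simp add: removable_def)
  have "bij_betw T (S - {x}) ({1..card S} - {T x})"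
    using bij x(1) by (auto simp: bij_betw_def inj_on_diff dest: inj_onD)
  also have "{1..card S} - {T x} = {1..n}" using x(2) n by auto
  finally have "bij_betw (restrict T (S - {x})) (S - {x}) {1..card (S - {x})}"
    using n bij_betw_cong[of "S - {x}" T "restrict T (S - {x})"] by simp
  then show "restrict T (S - {x}) \<in> SYT (S - {x})"
    using T by (simp add: SYT_def)
qed

lemma tableau_sum_empty: "tableau_sum w {} = 1"
proof -
  have "SYT {} = {\<lambda>_. undefined}"
    by (auto simp: SYT_def extensional_def bij_betw_def)
  then show ?thesis by (simp add: tableau_sum_def)
qed

text \<open>A standard tableau is a removable cell, which carries the largest entry, together with a standard
  tableau on the remaining cells; the factor for the last step splits off.\<close>
lemma tableau_sum_remove:
  assumes S: "diagram S" and ne: "S \<noteq> {}"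
  shows "tableau_sum w S = (\<Sum>x\<in>removable S. w S (S - {x}) * tableau_sum w (S - {x}))"
proof -
  have fin: "finite S" using S by (rule diagram_finite)
  let ?p = "\<lambda>S T. \<Prod>i = 1..card S. w (subshape S T i) (subshape S T (i - 1))"
  let ?last = "\<lambda>T. inv_into S T (card S)"
  have last: "?last T \<in> S" "T (?last T) = card S" if "T \<in> SYT S" for T
  proof -
    have "card S \<in> T ` S" using that ne fin
      by (auto simp: SYT_def bij_betw_def Suc_le_eq card_gt_0_iff)
    then show "?last T \<in> S" "T (?last T) = card S"
      by (auto intro: inv_into_into f_inv_into_f)
  qed
  have "(\<Sum>x\<in>removable S. w S (S - {x}) * tableau_sum w (S - {x})) =
      (\<Sum>x\<in>removable S. \<Sum>T\<in>SYT (S - {x}). w S (S - {x}) * ?p (S - {x}) T)"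
    by (simp add: tableau_sum_def sum_distrib_left)
  also have "\<dots> = (\<Sum>(x, T)\<in>(SIGMA x:removable S. SYT (S - {x})). w S (S - {x}) * ?p (S - {x}) T)"
    using fin by (intro sum.Sigma) (auto intro: finite_removable finite_SYT)
  also have "\<dots> = (\<Sum>T\<in>SYT S. ?p S T)"
  proof (rule sum.reindex_bij_witness[where j = "\<lambda>(x, T). T(x := card S)"
        and i = "\<lambda>T. (?last T, restrict T (S - {?last T}))"])
    fix T assume T: "T \<in> SYT S"
    show "(case (?last T, restrict T (S - {?last T})) of (x, T) \<Rightarrow> T(x := card S)) = T"
      using last[OF T] T by (auto simp: fun_eq_iff SYT_def extensional_def)
    show "(?last T, restrict T (S - {?last T})) \<in> (SIGMA x:removable S. SYT (S - {x}))"
      using SYT_remove[OF S T last[OF T]] by simp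
  next
    fix a assume a: "a \<in> (SIGMA x:removable S. SYT (S - {x}))"
    obtain x T where xT: "a = (x, T)" "x \<in> removable S" "T \<in> SYT (S - {x})" using a by auto
    let ?T = "T(x := card S)"
    have T': "?T \<in> SYT S" using SYT_extend[OF S xT(2,3)] .
    have xS: "x \<in> S" using xT by (simp add: removable_def)
    show "(case a of (x, T) \<Rightarrow> T(x := card S)) \<in> SYT S" using T' xT by simp
    have "?T (?last ?T) = ?T x" using last(2)[OF T'] by simp
    moreover have "inj_on ?T S" using T' by (auto simp: SYT_def bij_betw_def)
    ultimately have lx: "?last ?T = x" using last(1)[OF T'] xS by (meson inj_onD)
    have "restrict ?T (S - {x}) = T"
      using xT(3) by (auto simp: fun_eq_iff SYT_def extensional_def)
    with lx show "(?last (case a of (x, T) \<Rightarrow> T(x := card S)),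
        restrict (case a of (x, T) \<Rightarrow> T(x := card S)) (S - {?last (case a of (x, T) \<Rightarrow> T(x := card S))})) = a"
      using xT by simp
    obtain n where n: "card S = Suc n" "card (S - {x}) = n"
      using fin xS by (metis card.remove)
    have sub: "subshape S ?T i = subshape (S - {x}) T i" if "i \<le> n" for i
      using that n by (auto simp: subshape_def)
    have "subshape (S - {x}) T n = S - {x}" "subshape S ?T (Suc n) = S"
      using SYT_le[OF xT(3)] SYT_le[OF T'] n by (auto simp: subshape_def le_SucI)
    moreover have "(\<Prod>i = 1..n. w (subshape S ?T i) (subshape S ?T (i - 1))) =
        (\<Prod>i = 1..n. w (subshape (S - {x}) T i) (subshape (S - {x}) T (i - 1)))"
    proof (rule prod.cong[OF refl])
      fix i assume "i \<in> {1..n}"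
      then have "i \<le> n" "i - 1 \<le> n" by auto
      then show "w (subshape S ?T i) (subshape S ?T (i - 1)) =
          w (subshape (S - {x}) T i) (subshape (S - {x}) T (i - 1))"
        by (simp only: sub)
    qed
    ultimately have "?p S ?T = w S (S - {x}) * ?p (S - {x}) T"
      using n sub[of n] by (simp add: mult.commute)
    then show "?p S (case a of (x, T) \<Rightarrow> T(x := card S)) = (case a of (x, T) \<Rightarrow> w S (S - {x}) * ?p (S - {x}) T)"
      using xT by simp
  qed
  finally show ?thesis by (simp add: tableau_sum_def)
qed

section \<open>Row lengths\<close>

definition row_len :: "cell set \<Rightarrow> nat \<Rightarrow> nat" where
  "row_len S r = card {c. (r, c) \<in> S}"

lemma row_cells_interval:
  assumes S: "diagram S"
  shows "{c. (r, c) \<in> S} = {1..row_len S r}"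
proof -
  let ?C = "{c. (r, c) \<in> S}"
  have "?C \<subseteq> snd ` S" by force
  then have fin: "finite ?C" using diagram_finite[OF S] by (meson finite_imageI finite_subset)
  show ?thesis
  proof (cases "?C = {}")
    case True
    then show ?thesis by (simp add: row_len_def)
  next
    case False
    let ?m = "Max ?C"
    have m: "(r, ?m) \<in> S" using Max_in[OF fin False] by simp
    have "?C = {1..?m}"
    proof (intro equalityI subsetI)
      fix c assume "c \<in> ?C"
      then show "c \<in> {1..?m}" using fin diagram_ge_1[OF S, of r c] by simp
    next
      fix c assume "c \<in> {1..?m}"
      then show "c \<in> ?C" using diagram_down[OF S m, of r c] diagram_ge_1[OF S m] by simp
    qed
    moreover from this have "row_len S r = ?m" unfolding row_len_def by (metis card_atLeastAtMost diff_Suc_1 plus_1_eq_Suc add.commute)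
    ultimately show ?thesis by simp
  qed
qed

lemma mem_diagram_iff:
  assumes S: "diagram S"
  shows "(r, c) \<in> S \<longleftrightarrow> 1 \<le> c \<and> c \<le> row_len S r"
  using row_cells_interval[OF S, of r] by (simp add: set_eq_iff)

lemma row_len_antimono:
  assumes S: "diagram S" and "1 \<le> i" "i \<le> j"
  shows "row_len S j \<le> row_len S i"
proof (cases "row_len S j = 0")
  case False
  then have "(j, row_len S j) \<in> S" by (simp add: mem_diagram_iff[OF S])
  then have "(i, row_len S j) \<in> S"
    using diagram_down[OF S, of j "row_len S j" i "row_len S j"] assms False by simp
  then show ?thesis by (simp add: mem_diagram_iff[OF S])
qed simp

lemma row_len_0: "diagram S \<Longrightarrow> row_len S 0 = 0"
  using mem_diagram_iff[of S 0 "row_len S 0"] diagram_ge_1[of S 0 "row_len S 0"]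
  by (cases "row_len S 0 = 0") auto

lemma row_len_pos_imp: "diagram S \<Longrightarrow> 0 < row_len S r \<Longrightarrow> 1 \<le> r"
  using row_len_0[of S] by (cases r) auto

lemma diagram_row_bound:
  assumes S: "diagram S"
  obtains N where "\<forall>i>N. row_len S i = 0"
proof -
  have "finite (fst ` S)" using diagram_finite[OF S] by simp
  then obtain N where N: "\<And>i. i \<in> fst ` S \<Longrightarrow> i \<le> N"
    by (meson finite_nat_set_iff_bounded_le)
  have "row_len S i = 0" if "i > N" for i
  proof -
    have "{c. (i, c) \<in> S} = {}" using N[of i] that by force
    then show ?thesis by (simp add: row_len_def)
  qed
  then show thesis using that by blast
qed

text \<open>This reduces adding or removing a cell to changing one value of a weakly decreasing function.\<close>
lemma diagram_of_rows:
  assumes anti: "\<And>i j. 1 \<le> i \<Longrightarrow> i \<le> j \<Longrightarrow> m j \<le> m i" and bound: "\<And>i. i > N \<Longrightarrow> m i = 0"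
  shows "diagram {(r, c). 1 \<le> r \<and> 1 \<le> c \<and> c \<le> m r}"
  unfolding diagram_def
proof (intro conjI)
  have "{(r, c). 1 \<le> r \<and> 1 \<le> c \<and> c \<le> m r} \<subseteq> {1..N} \<times> {1..m 1}"
  proof clarify
    fix r c assume "1 \<le> r" "1 \<le> c" "c \<le> m r"
    then show "r \<in> {1..N} \<and> c \<in> {1..m 1}"
      using bound[of r] anti[of 1 r] by (cases "r \<le> N") auto
  qed
  then show "finite {(r, c). 1 \<le> r \<and> 1 \<le> c \<and> c \<le> m r}"
    by (rule finite_subset) simp
next
  have "c' \<le> m r'" if "c \<le> m r" "1 \<le> r'" "r' \<le> r" "c' \<le> c" for r c r' c'
    using anti[of r' r] that by linarith
  then show "\<forall>r c r' c'. (r, c) \<in> {(r, c). 1 \<le> r \<and> 1 \<le> c \<and> c \<le> m r} \<longrightarrow> 1 \<le> r' \<longrightarrow> r' \<le> r \<longrightarrow>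
      1 \<le> c' \<longrightarrow> c' \<le> c \<longrightarrow> (r', c') \<in> {(r, c). 1 \<le> r \<and> 1 \<le> c \<and> c \<le> m r}"
    by blast
qed auto

lemma arm_diagram: "diagram S \<Longrightarrow> arm S (r, c) = row_len S r - c"
proof -
  assume S: "diagram S"
  have "{y \<in> S. fst y = r \<and> c < snd y} = Pair r ` {d. (r, d) \<in> S \<and> c < d}" by force
  also have "{d. (r, d) \<in> S \<and> c < d} = {c + 1..row_len S r}"
    by (auto simp: mem_diagram_iff[OF S])
  finally show ?thesis by (simp add: arm_def card_image inj_on_def)
qed

lemma leg_diagram:
  assumes S: "diagram S" and "1 \<le> r" "r \<le> k" "1 \<le> c" and up: "c \<le> row_len S k" "row_len S (k + 1) < c"
  shows "leg S (r, c) = k - r"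
proof -
  have "(i, c) \<in> S \<longleftrightarrow> i \<le> k" if "r < i" for i
  proof
    assume "(i, c) \<in> S"
    then show "i \<le> k"
      using row_len_antimono[OF S, of "k + 1" i] up by (cases "i \<le> k") (auto simp: mem_diagram_iff[OF S])
  next
    assume "i \<le> k"
    then show "(i, c) \<in> S"
      using row_len_antimono[OF S, of i k] up assms(4) that by (auto simp: mem_diagram_iff[OF S])
  qed
  then have "{y \<in> S. snd y = c \<and> r < fst y} = (\<lambda>i. (i, c)) ` {r + 1..k}"
    by force
  then show ?thesis by (simp add: leg_def card_image inj_on_def)
qed

lemma addable_eq:
  assumes S: "diagram S" and N: "\<forall>i>N. row_len S i = 0"
  shows "addable S = (\<lambda>r. (r, row_len S r + 1)) ` {r\<in>{1..N+1}. r = 1 \<or> row_len S r < row_len S (r - 1)}"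
proof (intro equalityI subsetI)
  fix x assume x: "x \<in> addable S"
  obtain r c where rc: "x = (r, c)" by (cases x)
  have D: "diagram (insert (r, c) S)" and nS: "(r, c) \<notin> S" using x rc by (auto simp: addable_def)
  have ge: "1 \<le> r" "1 \<le> c" using diagram_ge_1[OF D, of r c] by auto
  have lt: "row_len S r < c" using nS ge by (simp add: mem_diagram_iff[OF S])
  have "c = row_len S r + 1"
  proof (rule ccontr)
    assume "c \<noteq> row_len S r + 1"
    then have "(r, row_len S r + 1) \<in> insert (r, c) S"
      using diagram_down[OF D, of r c r "row_len S r + 1"] lt ge by simp
    then show False using \<open>c \<noteq> row_len S r + 1\<close> by (simp add: mem_diagram_iff[OF S])
  qed
  moreover have below: "row_len S r < row_len S (r - 1)" if "r \<noteq> 1"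
  proof -
    have "(r - 1, c) \<in> insert (r, c) S"
      using diagram_down[OF D, of r c "r - 1" c] ge that by simp
    then have "(r - 1, c) \<in> S" using ge by auto
    then show ?thesis using lt by (simp add: mem_diagram_iff[OF S])
  qed
  moreover have "r \<le> N + 1"
  proof (rule ccontr)
    assume "\<not> r \<le> N + 1"
    then have "r \<noteq> 1" "row_len S (r - 1) = 0" using N[rule_format, of "r - 1"] by auto
    then show False using below by simp
  qed
  ultimately show "x \<in> (\<lambda>r. (r, row_len S r + 1)) ` {r\<in>{1..N+1}. r = 1 \<or> row_len S r < row_len S (r - 1)}"
    using rc ge by auto
next
  fix x assume "x \<in> (\<lambda>r. (r, row_len S r + 1)) ` {r\<in>{1..N+1}. r = 1 \<or> row_len S r < row_len S (r - 1)}"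
  then obtain r where r: "1 \<le> r" "r = 1 \<or> row_len S r < row_len S (r - 1)" "x = (r, row_len S r + 1)"
    by auto
  let ?m = "(row_len S)(r := row_len S r + 1)"
  have eq: "{(i, c). 1 \<le> i \<and> 1 \<le> c \<and> c \<le> ?m i} = insert x S"
    using r row_len_pos_imp[OF S] by (auto simp: mem_diagram_iff[OF S] split: if_splits)
  have "diagram (insert x S)"
    unfolding eq[symmetric]
  proof (rule diagram_of_rows[where N = "max N r"])
    fix i j :: nat assume "1 \<le> i" "i \<le> j"
    moreover have "row_len S r + 1 \<le> row_len S i" if "1 \<le> i" "i < r"
    proof -
      have "i \<le> r - 1" "r \<noteq> 1" using that by auto
      then show ?thesis using row_len_antimono[OF S that(1), of "r - 1"] r(2) by simp
    qed
    ultimately show "?m j \<le> ?m i"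
      using row_len_antimono[OF S, of i j] by (cases "i = j") auto
  qed (use N in auto)
  moreover have "x \<notin> S" using r by (simp add: mem_diagram_iff[OF S])
  ultimately show "x \<in> addable S" by (simp add: addable_def)
qed

lemma finite_addable:
  assumes "diagram S"
  shows "finite (addable S)"
proof -
  obtain N where "\<forall>i>N. row_len S i = 0" using diagram_row_bound[OF assms] by blast
  then show ?thesis by (subst addable_eq[OF assms]) auto
qed

lemma removable_eq:
  assumes S: "diagram S" and N: "\<forall>i>N. row_len S i = 0"
  shows "removable S = (\<lambda>r. (r, row_len S r)) ` {r\<in>{1..N}. row_len S (r + 1) < row_len S r}"
proof (intro equalityI subsetI)
  fix x assume x: "x \<in> removable S"
  obtain r c where rc: "x = (r, c)" by (cases x)
  have D: "diagram (S - {(r, c)})" and xS: "(r, c) \<in> S" using x rc by (auto simp: removable_def)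
  have ge: "1 \<le> r" "1 \<le> c" using diagram_ge_1[OF S xS] by auto
  have le: "c \<le> row_len S r" using xS by (simp add: mem_diagram_iff[OF S])
  have "c = row_len S r"
  proof (rule ccontr)
    assume "c \<noteq> row_len S r"
    then have "(r, row_len S r) \<in> S - {(r, c)}"
      using le ge by (simp add: mem_diagram_iff[OF S])
    then show False using diagram_down[OF D, of r "row_len S r" r c] le ge by simp
  qed
  moreover have "row_len S (r + 1) < c"
  proof (rule ccontr)
    assume "\<not> row_len S (r + 1) < c"
    then have "(r + 1, c) \<in> S - {(r, c)}" using ge by (simp add: mem_diagram_iff[OF S])
    then show False using diagram_down[OF D, of "r + 1" c r c] ge by simp
  qed
  moreover have "r \<le> N" using N[rule_format, of r] le ge by (cases "r \<le> N") auto
  ultimately show "x \<in> (\<lambda>r. (r, row_len S r)) ` {r\<in>{1..N}. row_len S (r + 1) < row_len S r}"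
    using rc ge by auto
next
  fix x assume "x \<in> (\<lambda>r. (r, row_len S r)) ` {r\<in>{1..N}. row_len S (r + 1) < row_len S r}"
  then obtain r where r: "1 \<le> r" "row_len S (r + 1) < row_len S r" "x = (r, row_len S r)" by auto
  let ?m = "(row_len S)(r := row_len S r - 1)"
  have eq: "{(i, c). 1 \<le> i \<and> 1 \<le> c \<and> c \<le> ?m i} = S - {x}"
    using r row_len_pos_imp[OF S] by (auto simp: mem_diagram_iff[OF S] split: if_splits)
  have "diagram (S - {x})"
    unfolding eq[symmetric]
  proof (rule diagram_of_rows[where N = "max N r"])
    fix i j :: nat assume "1 \<le> i" "i \<le> j"
    moreover have "row_len S j \<le> row_len S r - 1" if "r < j"
      using row_len_antimono[OF S, of "r + 1" j] r that by auto
    ultimately show "?m j \<le> ?m i"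
      using row_len_antimono[OF S, of i j] by (cases "i = j") auto
  qed (use N in auto)
  moreover have "x \<in> S" using r by (simp add: mem_diagram_iff[OF S])
  ultimately show "x \<in> removable S" by (simp add: removable_def)
qed

lemma row_len_insert:
  assumes "diagram S" "x \<in> addable S"
  shows "row_len (insert x S) = (row_len S)(fst x := row_len S (fst x) + 1)"
proof
  fix i
  have S: "finite S" "x \<notin> S" using assms by (auto simp: addable_def diagram_finite)
  have "finite {c. (i, c) \<in> S}" using row_cells_interval[OF assms(1), of i] by simp
  moreover have "{c. (i, c) \<in> insert x S} = (if i = fst x then insert (snd x) {c. (i, c) \<in> S} else {c. (i, c) \<in> S})"
    by (cases x) auto
  ultimately show "row_len (insert x S) i = ((row_len S)(fst x := row_len S (fst x) + 1)) i"
    using S by (auto simp: row_len_def)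
qed

section \<open>A sum of residues\<close>

text \<open>The sum is the coefficient of \<open>x\<^bsup>card Z - 1\<^esup>\<close> in the Lagrange interpolation of \<open>p\<close> at the points of \<open>Z\<close>,
  and interpolation reproduces \<open>p\<close>. Equivalently, the residues of \<open>p(x) / \<Prod>\<^bsub>z \<in> Z\<^esub> (x - z)\<close> at the points of
  \<open>Z\<close> add up to minus the residue at infinity.\<close>
lemma sum_divided_difference:
  fixes p :: "'a::field poly"
  assumes "finite Z" and deg: "degree p < card Z"
  shows "(\<Sum>z\<in>Z. poly p z / (\<Prod>y\<in>Z - {z}. z - y)) = coeff p (card Z - 1)"
proof -
  define n where "n = card Z - 1"
  define w where "w z = poly p z / (\<Prod>y\<in>Z - {z}. z - y)" for z
  define L where "L z = (\<Prod>y\<in>Z - {z}. [:- y, 1:])" for z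
  have pos: "card Z > 0" using deg by simp
  have L: "degree (L z) = n" "coeff (L z) n = 1" if "z \<in> Z" for z
  proof -
    have "degree (L z) = (\<Sum>y\<in>Z - {z}. degree [:- y, 1:])"
      unfolding L_def by (rule degree_prod_sum_eq) simp
    then show d: "degree (L z) = n" using that \<open>finite Z\<close> by (simp add: n_def)
    have "lead_coeff (L z) = 1" unfolding L_def lead_coeff_prod by simp
    then show "coeff (L z) n = 1" using d by simp
  qed
  define P where "P = (\<Sum>z\<in>Z. smult (w z) (L z))"
  have "P = p"
  proof (rule poly_eqI_degree[of Z])
    fix x assume x: "x \<in> Z"
    have "poly P x = (\<Sum>z\<in>Z. w z * (\<Prod>y\<in>Z - {z}. x - y))"
      by (simp add: P_def L_def poly_sum poly_prod)
    also have "\<dots> = (\<Sum>z\<in>{x}. w z * (\<Prod>y\<in>Z - {z}. x - y))"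
      using \<open>finite Z\<close> x by (intro sum.mono_neutral_right) auto
    also have "\<dots> = poly p x"
      using \<open>finite Z\<close> by (simp add: w_def)
    finally show "poly P x = poly p x" .
  next
    have "degree P \<le> n" unfolding P_def
      using L by (intro degree_sum_le) (auto simp: \<open>finite Z\<close> intro: order_trans[OF degree_smult_le])
    then show "degree P < card Z" using pos by (simp add: n_def)
  qed (use deg in auto)
  then have "coeff p n = (\<Sum>z\<in>Z. w z * coeff (L z) n)"
    by (auto simp: P_def coeff_sum)
  also have "\<dots> = (\<Sum>z\<in>Z. w z)" by (simp add: L)
  finally show ?thesis by (simp add: w_def n_def)
qed

text \<open>The sum of the residues of \<open>f(z) / z\<close>, for the function \<open>f\<close> of the introduction, at its simple poles
  \<open>0\<close>, \<open>q y\<^sub>j\<close> and \<open>y\<^sub>k\<close>. The residue at \<open>0\<close> is \<open>t/q\<close>. The numerator factors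
  belonging to the pole itself give \<open>1 - t/q\<close> at \<open>q y\<^sub>r\<close> and \<open>1 - q/t\<close> at \<open>y\<^sub>r\<close>, and dividing by
  \<open>1 - t/q\<close> leaves the stated identity.\<close>
lemma residue_sum:
  fixes y :: "nat \<Rightarrow> 'a::field" and q t :: 'a and N :: nat
  assumes q: "q \<noteq> 0" "q \<noteq> t" and t: "t \<noteq> 0"
    and y0: "\<And>j. y j \<noteq> 0"
    and inj: "\<And>i j. y i = y j \<Longrightarrow> i = j"
    and qy: "\<And>i j. q * y i \<noteq> y j"
  defines "J \<equiv> {1..N + 1}" and "K \<equiv> {1..N}"
  shows "(\<Sum>r\<in>J. (\<Prod>j\<in>J - {r}. (q * y r - t * y j) / (q * y r - q * y j)) *
            (\<Prod>k\<in>K. (q * y r - q / t * y k) / (q * y r - y k)))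
       - q / t * (\<Sum>r\<in>K. (\<Prod>j\<in>J. (y r - t * y j) / (y r - q * y j)) *
            (\<Prod>k\<in>K - {r}. (y r - q / t * y k) / (y r - y k))) = 1"
    (is "(\<Sum>r\<in>J. ?U r) - q / t * (\<Sum>r\<in>K. ?D r) = 1")
proof -
  have [simp]: "finite J" "finite K" by (auto simp: J_def K_def)
  define A where "A = (\<lambda>j. q * y j) ` J"
  define B where "B = y ` K"
  have injA: "inj_on (\<lambda>j. q * y j) J" and injB: "inj_on y K"
    using inj q by (auto simp: inj_on_def)
  have [simp]: "finite A" "finite B" by (simp_all add: A_def B_def)
  have AB: "A \<inter> B = {}" "0 \<notin> A" "0 \<notin> B" using qy y0 q by (auto simp: A_def B_def)
  let ?Z = "insert 0 (A \<union> B)"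
  define P where "P = (\<Prod>j\<in>J. [:- (t * y j), 1:]) * (\<Prod>k\<in>K. [:- (q / t * y k), 1:])"
  have cA: "card A = N + 1" and cB: "card B = N"
    unfolding A_def B_def by (simp_all add: card_image injA injB) (simp_all add: J_def K_def)
  have cardZ: "card ?Z = 2 * N + 2"
    using AB cA cB by (simp add: card_Un_disjoint)
  have "degree P = 2 * N + 1"
    unfolding P_def by (subst degree_mult_eq) (simp_all add: degree_prod_sum_eq, simp add: J_def K_def)
  moreover have "lead_coeff P = 1"
    unfolding P_def lead_coeff_mult lead_coeff_prod by simp
  ultimately have P: "degree P < card ?Z" "coeff P (card ?Z - 1) = 1"
    by (simp_all add: cardZ)
  have polyP: "poly P z = (\<Prod>j\<in>J. z - t * y j) * (\<Prod>k\<in>K. z - q / t * y k)" for z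
    by (simp add: P_def poly_prod)
  let ?h = "\<lambda>z. poly P z / (\<Prod>y\<in>?Z - {z}. z - y)"
  have "1 = (\<Sum>z\<in>?Z. ?h z)"
    using sum_divided_difference[of ?Z P] P by simp
  also have "\<dots> = ?h 0 + (\<Sum>z\<in>A. ?h z) + (\<Sum>z\<in>B. ?h z)"
    using AB by (subst sum.insert) (auto simp: sum.union_disjoint)
  also have "(\<Sum>z\<in>A. ?h z) = (\<Sum>r\<in>J. ?h (q * y r))"
    unfolding A_def by (simp add: sum.reindex[OF injA])
  also have "(\<Sum>z\<in>B. ?h z) = (\<Sum>r\<in>K. ?h (y r))"
    unfolding B_def by (simp add: sum.reindex[OF injB])
  also have "?h 0 = t / q"
  proof -
    have "?Z - {0} = A \<union> B" using AB by auto
    then have "?h 0 = ((\<Prod>j\<in>J. 0 - t * y j) * (\<Prod>k\<in>K. 0 - q / t * y k)) / ((\<Prod>x\<in>A. 0 - x) * (\<Prod>x\<in>B. 0 - x))"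
      using AB by (simp add: polyP prod.union_disjoint)
    also have "\<dots> = (\<Prod>j\<in>J. (0 - t * y j) / (0 - q * y j)) * (\<Prod>k\<in>K. (0 - q / t * y k) / (0 - y k))"
      unfolding A_def B_def prod.reindex[OF injA] prod.reindex[OF injB] prod_dividef by simp
    also have "\<dots> = (\<Prod>j\<in>J. t / q) * (\<Prod>k\<in>K. q / t)"
      using y0 by simp
    also have "\<dots> = t / q * ((t / q) * (q / t)) ^ N"
      unfolding power_mult_distrib by (simp add: J_def K_def)
    also have "\<dots> = t / q" using q t by simp
    finally show ?thesis .
  qed
  also have "(\<Sum>r\<in>J. ?h (q * y r)) = (\<Sum>r\<in>J. (1 - t / q) * ?U r)"
  proof (rule sum.cong[OF refl])
    fix r assume r: "r \<in> J"
    have Z: "?Z - {q * y r} = insert 0 ((\<lambda>j. q * y j) ` (J - {r}) \<union> B)"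
      using AB y0 q inj r by (auto simp: A_def B_def)
    have i: "inj_on (\<lambda>j. q * y j) (J - {r})" using injA by (rule inj_on_diff)
    have d: "(\<lambda>j. q * y j) ` (J - {r}) \<inter> B = {}" "0 \<notin> (\<lambda>j. q * y j) ` (J - {r})"
      using AB by (auto simp: A_def)
    have "(\<Prod>x\<in>?Z - {q * y r}. q * y r - x) =
        q * y r * ((\<Prod>j\<in>J - {r}. q * y r - q * y j) * (\<Prod>k\<in>K. q * y r - y k))"
      unfolding Z using d AB
      by (simp add: prod.union_disjoint prod.reindex[OF i]) (simp add: B_def prod.reindex[OF injB])
    moreover have "poly P (q * y r) = (q * y r - t * y r) *
        ((\<Prod>j\<in>J - {r}. q * y r - t * y j) * (\<Prod>k\<in>K. q * y r - q / t * y k))"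
      using r by (simp add: polyP prod.remove[of J r] mult.assoc)
    ultimately have "?h (q * y r) = (q * y r - t * y r) / (q * y r) * ?U r"
      by (simp only: prod_dividef times_divide_times_eq)
    also have "(q * y r - t * y r) / (q * y r) = 1 - t / q"
      using q y0 by (simp add: field_simps)
    finally show "?h (q * y r) = (1 - t / q) * ?U r" .
  qed
  also have "(\<Sum>r\<in>K. ?h (y r)) = (\<Sum>r\<in>K. (1 - q / t) * ?D r)"
  proof (rule sum.cong[OF refl])
    fix r assume r: "r \<in> K"
    have Z: "?Z - {y r} = insert 0 (A \<union> y ` (K - {r}))"
      using AB y0 q inj r by (auto simp: A_def B_def)
    have i: "inj_on y (K - {r})" using injB by (rule inj_on_diff)
    have d: "A \<inter> y ` (K - {r}) = {}" "0 \<notin> y ` (K - {r})"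
      using AB by (auto simp: B_def)
    have "(\<Prod>x\<in>?Z - {y r}. y r - x) =
        y r * ((\<Prod>j\<in>J. y r - q * y j) * (\<Prod>k\<in>K - {r}. y r - y k))"
      unfolding Z using d AB
      by (simp add: prod.union_disjoint prod.reindex[OF i]) (simp add: A_def prod.reindex[OF injA])
    moreover have "poly P (y r) = (y r - q / t * y r) *
        ((\<Prod>j\<in>J. y r - t * y j) * (\<Prod>k\<in>K - {r}. y r - q / t * y k))"
      using r by (simp add: polyP prod.remove[of K r] mult_ac)
    ultimately have "?h (y r) = (y r - q / t * y r) / (y r) * ?D r"
      by (simp only: prod_dividef times_divide_times_eq)
    also have "(y r - q / t * y r) / (y r) = 1 - q / t"
      using y0[of r] by (simp add: diff_divide_distrib)
    finally show "?h (y r) = (1 - q / t) * ?D r" .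
  qed
  finally have eq: "1 = t / q + (1 - t / q) * sum ?U J + (1 - q / t) * sum ?D K"
    by (simp only: sum_distrib_left)
  have "(1 - t / q) * (sum ?U J - q / t * sum ?D K) = (1 - t / q) * sum ?U J + (1 - q / t) * sum ?D K"
    using q t by (simp add: field_simps)
  also have "\<dots> = (1 - t / q) * 1" using eq by (simp add: algebra_simps)
  finally show ?thesis using q by (subst (asm) mult_cancel_left) (simp add: field_simps)
qed

section \<open>One-cell weights as residues\<close>

definition row_weight :: "(nat \<Rightarrow> nat) \<Rightarrow> nat \<Rightarrow> ratfun_qt" where
  "row_weight m j = qvar ^ m j / tvar ^ j"

text \<open>The residues of \<open>f(z) / z\<close> at \<open>q y\<^sub>r\<close> and at \<open>y\<^sub>r\<close>, divided by \<open>1 - t/q\<close> and \<open>1 - q/t\<close> respectively.\<close>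
definition up_residue :: "(nat \<Rightarrow> nat) \<Rightarrow> nat \<Rightarrow> nat \<Rightarrow> ratfun_qt" where
  "up_residue m N r =
    (\<Prod>j\<in>{1..N + 1} - {r}. (qvar * row_weight m r - tvar * row_weight m j) / (qvar * row_weight m r - qvar * row_weight m j)) *
    (\<Prod>k\<in>{1..N}. (qvar * row_weight m r - qvar / tvar * row_weight m k) / (qvar * row_weight m r - row_weight m k))"

definition down_residue :: "(nat \<Rightarrow> nat) \<Rightarrow> nat \<Rightarrow> nat \<Rightarrow> ratfun_qt" where
  "down_residue m N r =
    (\<Prod>j\<in>{1..N + 1}. (row_weight m r - tvar * row_weight m j) / (row_weight m r - qvar * row_weight m j)) *
    (\<Prod>k\<in>{1..N} - {r}. (row_weight m r - qvar / tvar * row_weight m k) / (row_weight m r - row_weight m k))"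

lemma row_weight_nonzero [simp]: "row_weight m j \<noteq> 0"
  by (simp add: row_weight_def)

text \<open>The poles are distinct because they are distinct monomials: the power of \<open>t\<close> determines the row,
  and within one row \<open>q y\<^sub>r\<close> and \<open>y\<^sub>r\<close> differ.\<close>
lemma residue_identity:
  "(\<Sum>r = 1..N + 1. up_residue m N r) - qvar / tvar * (\<Sum>r = 1..N. down_residue m N r) = 1"
  unfolding up_residue_def down_residue_def
proof (rule residue_sum)
  fix i j
  show "i = j" if "row_weight m i = row_weight m j"
  proof -
    have "qvar ^ m i * tvar ^ j = qvar ^ m j * tvar ^ i"
      using that by (simp add: row_weight_def field_simps)
    then show ?thesis by (simp add: qt_monomial_inject)
  qed
  show "qvar * row_weight m i \<noteq> row_weight m j"
  proof
    assume "qvar * row_weight m i = row_weight m j"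
    then have "qvar ^ (m i + 1) * tvar ^ j = qvar ^ m j * tvar ^ i"
      by (simp add: row_weight_def field_simps)
    then show False unfolding qt_monomial_inject by auto
  qed
  show "qvar \<noteq> tvar" using qt_monomial_inject[of 1 0 0 1] by simp
qed simp_all

lemma up_residue_not_addable:
  assumes "1 < r" "r \<le> N + 1" "m r = m (r - 1)"
  shows "up_residue m N r = 0"
proof -
  have "row_weight m (r - 1) = tvar * row_weight m r"
    using assms by (cases r) (simp_all add: row_weight_def)
  then have "qvar * row_weight m r - qvar / tvar * row_weight m (r - 1) = 0" by simp
  moreover have "r - 1 \<in> {1..N}" using assms by auto
  ultimately show ?thesis unfolding up_residue_def
    by (metis (no_types, lifting) div_0 finite_atLeastAtMost mult_zero_right prod_zero)
qed

lemma down_residue_not_removable: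
  assumes "1 \<le> r" "r \<le> N" "m (r + 1) = m r"
  shows "down_residue m N r = 0"
proof -
  have "row_weight m r - tvar * row_weight m (r + 1) = 0"
    using assms by (simp add: row_weight_def)
  moreover have "r + 1 \<in> {1..N + 1}" using assms by auto
  ultimately show ?thesis unfolding down_residue_def
    by (metis (no_types, lifting) div_0 finite_atLeastAtMost mult_zero_left prod_zero)
qed

text \<open>Removing a cell from \<open>S\<close> is adding it to the smaller diagram. Shortening row \<open>r\<close> turns \<open>q y\<^sub>r\<close> into \<open>y\<^sub>r\<close>, so
  the residue for adding to the small diagram and the one for removing from the large one
  differ only in the factor that belongs to row \<open>r\<close> itself.\<close>
lemma up_residue_shrink:
  assumes r: "r \<in> {1..N}" and pos: "0 < m r"
  shows "up_residue (m(r := m r - 1)) N r = qvar / tvar * down_residue m N r"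
proof -
  define m' where "m' = m(r := m r - 1)"
  let ?y = "row_weight m"
  have yr: "row_weight m' r = ?y r / qvar" using pos by (cases "m r") (simp_all add: row_weight_def m'_def)
  have yj: "row_weight m' j = ?y j" if "j \<noteq> r" for j using that by (simp add: row_weight_def m'_def)
  let ?A = "\<Prod>j\<in>{1..N + 1} - {r}. (?y r - tvar * ?y j) / (?y r - qvar * ?y j)"
  let ?B = "\<Prod>k\<in>{1..N} - {r}. (?y r - qvar / tvar * ?y k) / (?y r - ?y k)"
  have up: "up_residue m' N r = ?A * ((?y r - 1 / tvar * ?y r) / (?y r - ?y r / qvar) * ?B)"
    unfolding up_residue_def prod.remove[OF finite_atLeastAtMost r]
    by (simp add: yr yj)
  have down: "down_residue m N r = (?y r - tvar * ?y r) / (?y r - qvar * ?y r) * ?A * ?B"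
  proof -
    have "r \<in> {1..N + 1}" using r by simp
    then show ?thesis
      unfolding down_residue_def by (subst prod.remove[of _ r]) simp_all
  qed
  have ratio: "(?y r - 1 / tvar * ?y r) / (?y r - ?y r / qvar) =
      qvar / tvar * ((?y r - tvar * ?y r) / (?y r - qvar * ?y r))"
  proof -
    have "?y r - 1 / tvar * ?y r = - (?y r / tvar) * (1 - tvar)" "?y r - ?y r / qvar = - (?y r / qvar) * (1 - qvar)"
      "?y r - tvar * ?y r = ?y r * (1 - tvar)" "?y r - qvar * ?y r = ?y r * (1 - qvar)"
      by (simp_all add: field_simps)
    then show ?thesis by simp
  qed
  show ?thesis
    unfolding m'_def[symmetric] up down ratio by (simp only: mult_ac)
qed

lemma prod_telescope_interval:
  fixes f :: "nat \<Rightarrow> 'a::field"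
  assumes "a \<le> b" and "\<And>j. f j \<noteq> 0"
  shows "(\<Prod>j = a + 1..b. f j / f (j - 1)) = f b / f a"
  using assms(1) by (induction b rule: dec_induct) (simp_all add: assms(2))

text \<open>The next three lemmas translate single factors \<open>b\<close> into factors of \<open>f\<close> at \<open>z = q y\<^sub>r\<close>. A cell in the
  column of the new cell, in a lower row \<open>i\<close>, contributes exactly the two factors of \<open>f\<close> with index \<open>i\<close>.\<close>
lemma column_factor:
  assumes "i < r" "m r < m i"
  shows "b_val (m i - (m r + 1)) (r - i) / b_val (m i - (m r + 1)) (r - 1 - i) =
    (qvar * row_weight m r - tvar * row_weight m i) / (qvar * row_weight m r - qvar * row_weight m i) *
    ((qvar * row_weight m r - qvar / tvar * row_weight m i) / (qvar * row_weight m r - row_weight m i))"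
proof -
  define a l where "a = m i - (m r + 1)" and "l = r - 1 - i"
  have ml: "m i = m r + a + 1" "r = i + l + 1" using assms by (auto simp: a_def l_def)
  define X where "X = row_weight m r"
  have X: "row_weight m i = X * (qvar ^ (a + 1) * tvar ^ (l + 1))"
    by (simp add: X_def row_weight_def ml(1)) (simp add: ml(2) power_add)
  have [simp]: "X \<noteq> 0" by (simp add: X_def)
  have f: "qvar * X - tvar * row_weight m i = X * qvar * (1 - qvar ^ a * tvar ^ (l + 1 + 1))"
    "qvar * X - qvar * row_weight m i = X * qvar * (1 - qvar ^ (a + 1) * tvar ^ (l + 1))"
    "qvar * X - qvar / tvar * row_weight m i = X * qvar * (1 - qvar ^ (a + 1) * tvar ^ l)"
    "qvar * X - row_weight m i = X * qvar * (1 - qvar ^ a * tvar ^ (l + 1))"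
    by (simp_all add: X field_simps)
  have "r - i = l + 1" using ml by simp
  then show ?thesis
    unfolding X_def[symmetric] f a_def[symmetric] l_def[symmetric] \<open>r - i = l + 1\<close> b_val_def by simp
qed

lemma row_factor_numerator:
  assumes "r \<le> k" "m k \<le> m r"
  shows "b_val (m r - m k) (k - r) =
    tvar / qvar * ((qvar * row_weight m r - qvar / tvar * row_weight m k) / (qvar * row_weight m r - row_weight m k))"
proof -
  define a l where "a = m r - m k" and "l = k - r"
  have ml: "m r = m k + a" "k = r + l" using assms by (auto simp: a_def l_def)
  define Y where "Y = row_weight m k"
  have Y: "row_weight m r = Y * (qvar ^ a * tvar ^ l)"
    by (simp add: Y_def row_weight_def ml(1)) (simp add: ml(2) power_add)
  have [simp]: "Y \<noteq> 0" by (simp add: Y_def)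
  have f: "qvar * row_weight m r - qvar / tvar * Y = - (qvar / tvar * Y) * (1 - qvar ^ a * tvar ^ (l + 1))"
    "qvar * row_weight m r - Y = - Y * (1 - qvar ^ (a + 1) * tvar ^ l)"
    by (simp_all add: Y field_simps)
  show ?thesis
    unfolding Y_def[symmetric] f a_def[symmetric] l_def[symmetric] b_val_def by simp
qed

lemma row_factor_denominator:
  assumes "r < k" "m k \<le> m r"
  shows "1 / b_val (m r - m k) (k - 1 - r) =
    qvar / tvar * ((qvar * row_weight m r - tvar * row_weight m k) / (qvar * row_weight m r - qvar * row_weight m k))"
proof -
  define a l where "a = m r - m k" and "l = k - 1 - r"
  have ml: "m r = m k + a" "k = r + l + 1" using assms by (auto simp: a_def l_def)
  define Y where "Y = row_weight m k"
  have Y: "row_weight m r = Y * (qvar ^ a * tvar ^ (l + 1))"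
    by (simp add: Y_def row_weight_def ml(1)) (simp add: ml(2) power_add)
  have [simp]: "Y \<noteq> 0" by (simp add: Y_def)
  have f: "qvar * row_weight m r - tvar * Y = - (tvar * Y) * (1 - qvar ^ (a + 1) * tvar ^ l)"
    "qvar * row_weight m r - qvar * Y = - (qvar * Y) * (1 - qvar ^ a * tvar ^ (l + 1))"
    by (simp_all add: Y field_simps)
  show ?thesis
    unfolding Y_def[symmetric] f a_def[symmetric] l_def[symmetric] b_val_def by simp
qed

text \<open>The cells of row \<open>r\<close> whose columns have height \<open>k\<close> share the leg-length \<open>k - r\<close>, and their arm-lengths
  are consecutive; so their contributions telescope to one quotient for each row \<open>k \<ge> r\<close>. The quotient is 1
  if there are no such cells.\<close>
lemma row_product:
  assumes S: "diagram S" and r: "1 \<le> r" "r \<le> K"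
  defines "m \<equiv> row_len S"
  shows "(\<Prod>j = m K + 1..m r. b_val (m r - j) (leg S (r, j)) / b_val (m r - (j - 1)) (leg S (r, j))) =
    (\<Prod>k = r..<K. b_val (m r - m k) (k - r) / b_val (m r - m (k + 1)) (k - r))"
  using r(2)
proof (induction K rule: dec_induct)
  case base
  then show ?case by simp
next
  case (step K)
  let ?f = "\<lambda>j. b_val (m r - j) (leg S (r, j)) / b_val (m r - (j - 1)) (leg S (r, j))"
  have le: "m (K + 1) \<le> m K" "m K \<le> m r"
    using row_len_antimono[OF S, of K "K + 1"] row_len_antimono[OF S, of r K] r(1) step(1) by (auto simp: m_def)
  have split: "{m (K + 1) + 1..m r} = {m (K + 1) + 1..m K} \<union> {m K + 1..m r}"
    using le by auto
  have "prod ?f {m (K + 1) + 1..m r} = prod ?f {m (K + 1) + 1..m K} * prod ?f {m K + 1..m r}"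
    unfolding split by (rule prod.union_disjoint) auto
  also have "prod ?f {m (K + 1) + 1..m K} =
      (\<Prod>j = m (K + 1) + 1..m K. b_val (m r - j) (K - r) / b_val (m r - (j - 1)) (K - r))"
  proof (rule prod.cong[OF refl])
    fix j assume "j \<in> {m (K + 1) + 1..m K}"
    then have "leg S (r, j) = K - r"
      using leg_diagram[OF S, of r K j] r(1) step(1) by (simp add: m_def)
    then show "?f j = b_val (m r - j) (K - r) / b_val (m r - (j - 1)) (K - r)" by simp
  qed
  also have "\<dots> = b_val (m r - m K) (K - r) / b_val (m r - m (K + 1)) (K - r)"
    using prod_telescope_interval[OF le(1), of "\<lambda>j. b_val (m r - j) (K - r)"] by simp
  finally show ?case using step by (simp add: mult.commute)
qed

text \<open>The rows below \<open>x\<close> come from \<open>\<phi>\<close> and give the factors of \<open>f\<close> with equal indices. The rows from \<open>x\<close> upwards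
  come from \<open>\<psi>\<close> and pair the factor with index \<open>k + 1\<close> in the first product of \<open>f\<close> with the factor with index \<open>k\<close>
  in the second; this skips index \<open>r\<close> in the first product, as a residue at \<open>q y\<^sub>r\<close> must.\<close>
lemma skew_weight_add:
  assumes S: "diagram S" and N: "\<forall>i>N. row_len S i = 0"
    and x: "x \<in> addable S"
  shows "psi_skew (insert x S) S * phi_skew (insert x S) S =
    (1 - tvar) / (1 - qvar) * up_residue (row_len S) N (fst x)"
proof -
  let ?m = "row_len S"
  obtain r where r: "1 \<le> r" "r \<le> N + 1" "r = 1 \<or> ?m r < ?m (r - 1)" "x = (r, ?m r + 1)"
    using x addable_eq[OF S N] by auto
  let ?c = "?m r + 1"
  let ?S = "insert x S"
  have D: "diagram ?S" and xS: "x \<notin> S" using x by (auto simp: addable_def)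
  have rl: "row_len ?S = ?m(r := ?c)" using row_len_insert[OF S x] r by simp
  have anti: "?m j \<le> ?m i" if "1 \<le> i" "i \<le> j" for i j using row_len_antimono[OF S that] .
  have above: "?c \<le> ?m i" if "1 \<le> i" "i < r" for i
  proof -
    have "i \<le> r - 1" "r \<noteq> 1" using that by auto
    then show ?thesis using anti[OF that(1), of "r - 1"] r(3) by simp
  qed
  have "leg ?S (r, ?c) = 0"
    using leg_diagram[OF D, of r r ?c] anti[of r "r + 1"] r(1) by (simp add: rl)
  then have "b_cell ?S (r, ?c) = (1 - tvar) / (1 - qvar)"
    by (simp add: b_cell_eq arm_diagram[OF D] rl b_val_def)
  then have bx: "b_cell ?S x = (1 - tvar) / (1 - qvar)" by (subst (2) r(4))
  have col: "{z \<in> S. snd z = snd x} = (\<lambda>i. (i, ?c)) ` {1..<r}"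
  proof -
    have "(i, ?c) \<in> S \<longleftrightarrow> 1 \<le> i \<and> i < r" for i
      using above[of i] anti[of r i] diagram_ge_1[OF S, of i ?c] r(1)
      by (auto simp: mem_diagram_iff[OF S] not_le[symmetric])
    then show ?thesis using r by force
  qed
  let ?U = "\<lambda>j. (qvar * row_weight ?m r - tvar * row_weight ?m j) / (qvar * row_weight ?m r - qvar * row_weight ?m j)"
  let ?V = "\<lambda>k. (qvar * row_weight ?m r - qvar / tvar * row_weight ?m k) / (qvar * row_weight ?m r - row_weight ?m k)"
  have "phi_skew ?S S = (1 - tvar) / (1 - qvar) * (\<Prod>i\<in>{1..<r}. b_cell ?S (i, ?c) / b_cell S (i, ?c))"
    unfolding phi_skew_insert[OF xS] bx col by (subst prod.reindex) (simp_all add: inj_on_def)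
  also have "(\<Prod>i\<in>{1..<r}. b_cell ?S (i, ?c) / b_cell S (i, ?c)) = (\<Prod>i\<in>{1..<r}. ?U i * ?V i)"
  proof (rule prod.cong[OF refl])
    fix i assume i: "i \<in> {1..<r}"
    then have ir: "1 \<le> i" "i < r" by auto
    then obtain s where s: "r = s + 1" "i \<le> s" by (metis Suc_eq_plus1 less_Suc_eq_le not0_implies_Suc not_less0)
    have "leg S (i, ?c) = s - i"
    proof (rule leg_diagram[OF S])
      show "?c \<le> ?m s" by (rule above) (use ir s in simp_all)
      show "?m (s + 1) < ?c" by (simp only: s(1))
    qed (use ir s in simp_all)
    then have "leg S (i, ?c) = r - 1 - i" by (simp only: s(1) add_diff_cancel_right')
    moreover have "leg ?S (i, ?c) = r - i"
      using ir anti[of r "r + 1"] r(1) by (intro leg_diagram[OF D]) (simp_all add: rl)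
    ultimately have "b_cell ?S (i, ?c) / b_cell S (i, ?c) =
        b_val (?m i - ?c) (r - i) / b_val (?m i - ?c) (r - 1 - i)"
      using ir by (simp add: b_cell_eq arm_diagram[OF S] arm_diagram[OF D] rl)
    also have "\<dots> = ?U i * ?V i"
      using above[OF ir] ir by (intro column_factor) simp_all
    finally show "b_cell ?S (i, ?c) / b_cell S (i, ?c) = ?U i * ?V i" .
  qed
  finally have phi: "phi_skew ?S S = (1 - tvar) / (1 - qvar) * (\<Prod>i\<in>{1..<r}. ?U i * ?V i)" .
  have row: "{z \<in> S. fst z = fst x} = Pair r ` {1..?m r}"
    using r by (force simp: mem_diagram_iff[OF S])
  have "psi_skew ?S S = (\<Prod>j\<in>{1..?m r}. b_cell S (r, j) / b_cell ?S (r, j))"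
    unfolding psi_skew_insert[OF xS] row by (subst prod.reindex) (simp_all add: inj_on_def)
  also have "\<dots> = (\<Prod>j\<in>{?m (N + 1) + 1..?m r}. b_val (?m r - j) (leg S (r, j)) / b_val (?m r - (j - 1)) (leg S (r, j)))"
  proof (rule prod.cong)
    show "{1..?m r} = {?m (N + 1) + 1..?m r}" using N by simp
  next
    fix j assume "j \<in> {?m (N + 1) + 1..?m r}"
    then have j: "1 \<le> j" "j \<le> ?m r" by auto
    have "leg ?S (r, j) = leg S (r, j)"
      by (rule leg_insert_other) (use j r(4) in simp)
    moreover have "?c - j = ?m r - (j - 1)" using j by simp
    ultimately show "b_cell S (r, j) / b_cell ?S (r, j) =
        b_val (?m r - j) (leg S (r, j)) / b_val (?m r - (j - 1)) (leg S (r, j))"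
      by (simp only: b_cell_eq arm_diagram[OF S] arm_diagram[OF D] rl fun_upd_same)
  qed
  also have "\<dots> = (\<Prod>k\<in>{r..<N + 1}. b_val (?m r - ?m k) (k - r) / b_val (?m r - ?m (k + 1)) (k - r))"
    using r(1,2) by (intro row_product[OF S])
  also have "\<dots> = (\<Prod>k\<in>{r..<N + 1}. ?U (k + 1) * ?V k)"
  proof (rule prod.cong[OF refl])
    fix k assume k: "k \<in> {r..<N + 1}"
    have "b_val (?m r - ?m k) (k - r) = tvar / qvar * ?V k"
      using k r(1) by (intro row_factor_numerator anti) simp_all
    moreover have "1 / b_val (?m r - ?m (k + 1)) (k + 1 - 1 - r) = qvar / tvar * ?U (k + 1)"
      using k r(1) by (intro row_factor_denominator anti) simp_all
    moreover have cancel: "tvar / qvar * v * (qvar / tvar * u) = u * v" for u v by simp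
    ultimately have "b_val (?m r - ?m k) (k - r) * (1 / b_val (?m r - ?m (k + 1)) (k + 1 - 1 - r)) =
        ?U (k + 1) * ?V k" by (simp only: cancel)
    then show "b_val (?m r - ?m k) (k - r) / b_val (?m r - ?m (k + 1)) (k - r) = ?U (k + 1) * ?V k"
      by (simp only: add_diff_cancel_right' times_divide_eq_right mult_1_right)
  qed
  finally have psi: "psi_skew ?S S = (\<Prod>k\<in>{r..<N + 1}. ?U (k + 1) * ?V k)" .
  have "{1..N + 1} - {r} = {1..<r} \<union> {r + 1..<N + 1 + 1}" and V: "{1..N} = {1..<r} \<union> {r..<N + 1}"
    using r(1,2) by auto
  then have "prod ?U ({1..N + 1} - {r}) = prod ?U {1..<r} * prod ?U {r + 1..<N + 1 + 1}"
    by (simp only:) (rule prod.union_disjoint, auto)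
  moreover have "prod ?V {1..N} = prod ?V {1..<r} * prod ?V {r..<N + 1}"
    unfolding V by (rule prod.union_disjoint) auto
  ultimately have "up_residue ?m N r =
      (prod ?U {1..<r} * prod ?U {r + 1..<N + 1 + 1}) * (prod ?V {1..<r} * prod ?V {r..<N + 1})"
    unfolding up_residue_def by (simp only:)
  also have "prod ?U {r + 1..<N + 1 + 1} = (\<Prod>k\<in>{r..<N + 1}. ?U (k + 1))"
    by (rule prod.shift_bounds_nat_ivl)
  finally have up: "up_residue ?m N (fst x) =
      (prod ?U {1..<r} * (\<Prod>k\<in>{r..<N + 1}. ?U (k + 1))) * (prod ?V {1..<r} * prod ?V {r..<N + 1})"
    by (simp only: r(4) fst_conv)
  have ac: "(u' * v') * (c * (u * v)) = c * ((u * u') * (v * v'))" for c u v u' v' :: ratfun_qt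
    by (simp only: mult_ac)
  show ?thesis
    unfolding phi psi prod.distrib up by (rule ac)
qed

lemma skew_weight_remove:
  assumes S: "diagram S" and N: "\<forall>i>N. row_len S i = 0"
    and x: "x \<in> removable S"
  shows "psi_skew S (S - {x}) * phi_skew S (S - {x}) =
    (1 - tvar) / (1 - qvar) * (qvar / tvar * down_residue (row_len S) N (fst x))"
proof -
  let ?T = "S - {x}"
  obtain r where r: "r \<in> {1..N}" "row_len S (r + 1) < row_len S r" "x = (r, row_len S r)"
    using x removable_eq[OF S N] by auto
  have T: "diagram ?T" "insert x ?T = S" using x by (auto simp: removable_def)
  then have add: "x \<in> addable ?T" using S by (simp add: addable_def)
  have "row_len S = (row_len ?T)(r := row_len ?T r + 1)"
    using row_len_insert[OF T(1) add] T(2) r by simp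
  then have rl: "row_len ?T = (row_len S)(r := row_len S r - 1)"
    by (metis add_diff_cancel_right' fun_upd_same fun_upd_triv fun_upd_upd)
  have fx: "fst x = r" and pos: "0 < row_len S r" using r by auto
  have "\<forall>i>N. row_len ?T i = 0" using N r(1) by (simp add: rl)
  from skew_weight_add[OF T(1) this add] show ?thesis
    unfolding T(2) rl fx up_residue_shrink[where m = "row_len S", OF r(1) pos] .
qed

text \<open>The diagonal entry of the relation \<open>D U - U D = c\<close>. The sums over addable and removable cells
  extend to all rows since the additional residues vanish.\<close>
lemma skew_weight_commutator:
  assumes S: "diagram S"
  shows "(\<Sum>x\<in>addable S. psi_skew (insert x S) S * phi_skew (insert x S) S) =
    (1 - tvar) / (1 - qvar) + (\<Sum>x\<in>removable S. psi_skew S (S - {x}) * phi_skew S (S - {x}))"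
proof -
  obtain N where N: "\<forall>i>N. row_len S i = 0" using diagram_row_bound[OF S] by blast
  let ?m = "row_len S" and ?c = "(1 - tvar) / (1 - qvar)"
  have anti: "?m j \<le> ?m i" if "1 \<le> i" "i \<le> j" for i j using row_len_antimono[OF S that] .
  let ?A = "{r \<in> {1..N + 1}. r = 1 \<or> ?m r < ?m (r - 1)}" and ?R = "{r \<in> {1..N}. ?m (r + 1) < ?m r}"
  have "(\<Sum>x\<in>addable S. psi_skew (insert x S) S * phi_skew (insert x S) S) =
      (\<Sum>x\<in>addable S. ?c * up_residue ?m N (fst x))"
    by (rule sum.cong[OF refl]) (rule skew_weight_add[OF S N])
  also have "\<dots> = (\<Sum>r\<in>?A. ?c * up_residue ?m N r)"
    unfolding addable_eq[OF S N] by (subst sum.reindex) (auto simp: inj_on_def)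
  also have "\<dots> = (\<Sum>r = 1..N + 1. ?c * up_residue ?m N r)"
  proof (rule sum.mono_neutral_left)
    show "\<forall>r\<in>{1..N + 1} - ?A. ?c * up_residue ?m N r = 0"
    proof
      fix r assume r: "r \<in> {1..N + 1} - ?A"
      then have "?m r = ?m (r - 1)" "1 < r" using anti[of "r - 1" r] by auto
      then show "?c * up_residue ?m N r = 0" using r by (simp add: up_residue_not_addable)
    qed
  qed auto
  finally have up: "(\<Sum>x\<in>addable S. psi_skew (insert x S) S * phi_skew (insert x S) S) =
      ?c * (\<Sum>r = 1..N + 1. up_residue ?m N r)" by (simp only: sum_distrib_left)
  have "(\<Sum>x\<in>removable S. psi_skew S (S - {x}) * phi_skew S (S - {x})) =
      (\<Sum>x\<in>removable S. ?c * (qvar / tvar * down_residue ?m N (fst x)))"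
    by (rule sum.cong[OF refl]) (rule skew_weight_remove[OF S N])
  also have "\<dots> = (\<Sum>r\<in>?R. ?c * (qvar / tvar * down_residue ?m N r))"
    unfolding removable_eq[OF S N] by (subst sum.reindex) (auto simp: inj_on_def)
  also have "\<dots> = (\<Sum>r = 1..N. ?c * (qvar / tvar * down_residue ?m N r))"
  proof (rule sum.mono_neutral_left)
    show "\<forall>r\<in>{1..N} - ?R. ?c * (qvar / tvar * down_residue ?m N r) = 0"
    proof
      fix r assume r: "r \<in> {1..N} - ?R"
      then have "?m (r + 1) = ?m r" using anti[of r "r + 1"] by auto
      then show "?c * (qvar / tvar * down_residue ?m N r) = 0"
        using r by (simp add: down_residue_not_removable)
    qed
  qed auto
  finally have down: "(\<Sum>x\<in>removable S. psi_skew S (S - {x}) * phi_skew S (S - {x})) =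
      ?c * (qvar / tvar * (\<Sum>r = 1..N. down_residue ?m N r))" by (simp only: sum_distrib_left)
  have "(\<Sum>r = 1..N + 1. up_residue ?m N r) = 1 + qvar / tvar * (\<Sum>r = 1..N. down_residue ?m N r)"
    using residue_identity[of ?m N] by (simp only: diff_eq_eq)
  then show ?thesis unfolding up down by (simp only: distrib_left mult_1_right)
qed

section \<open>The commutation relation applied to tableau sums\<close>

text \<open>Adding \<open>x\<close> and then removing \<open>y \<noteq> x\<close> can be done in the other order, and conversely: the
  diagrams needed are the intersection or the union of two that are already given.\<close>
lemma skew_add_remove:
  assumes S: "diagram S"
  defines "I \<equiv> (SIGMA x:addable S. removable (insert x S) - {x})"
    and "J \<equiv> (SIGMA y:removable S. addable (S - {y}) - {y})"
  shows "bij_betw prod.swap I J"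
proof (rule bij_betw_byWitness[where f' = prod.swap])
  show "prod.swap ` I \<subseteq> J"
  proof (rule image_subsetI)
    fix p assume "p \<in> I"
    then obtain x y where p: "p = (x, y)" "(x, y) \<in> I" by (cases p) auto
    then have x: "x \<notin> S" "diagram (insert x S)" and y: "y \<in> S" "y \<noteq> x" "diagram (insert x S - {y})"
      by (auto simp: I_def addable_def removable_def)
    have "S \<inter> (insert x S - {y}) = S - {y}" "insert x S - {y} = insert x (S - {y})" using x y by auto
    then have "diagram (S - {y})" "diagram (insert x (S - {y}))"
      using diagram_Int[OF S y(3)] y(3) by simp_all
    then show "prod.swap p \<in> J" using x y p by (simp add: J_def addable_def removable_def)
  qed
  show "prod.swap ` J \<subseteq> I"
  proof (rule image_subsetI)
    fix p assume "p \<in> J"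
    then obtain y x where p: "p = (y, x)" "(y, x) \<in> J" by (cases p) auto
    then have y: "y \<in> S" "diagram (S - {y})" and x: "x \<notin> S" "y \<noteq> x" "diagram (insert x (S - {y}))"
      by (auto simp: J_def addable_def removable_def)
    have "S \<union> insert x (S - {y}) = insert x S" "insert x (S - {y}) = insert x S - {y}" using x y by auto
    then have "diagram (insert x S)" "diagram (insert x S - {y})"
      using diagram_Un[OF S x(3)] x(3) by simp_all
    then show "prod.swap p \<in> I" using x y p by (simp add: I_def addable_def removable_def)
  qed
qed auto

text \<open>This is \<open>D B = (n + 1) c B\<close>, by induction on \<open>n\<close>: expand \<open>B\<close> by its recursion, use
  \<open>D U = U D + c\<close>, and apply the induction hypothesis to \<open>D B\<close> one level lower, where it yields \<open>n c B\<close>.\<close>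
lemma tableau_sum_phi_down:
  assumes "diagram S"
  shows "(\<Sum>x\<in>addable S. psi_skew (insert x S) S * tableau_sum phi_skew (insert x S)) =
    of_nat (card S + 1) * ((1 - tvar) / (1 - qvar)) * tableau_sum phi_skew S"
  using assms
proof (induction "card S" arbitrary: S rule: less_induct)
  case less
  note S = \<open>diagram S\<close>
  let ?B = "tableau_sum phi_skew" and ?c = "(1 - tvar) / (1 - qvar)"
  let ?d = "\<lambda>x S. psi_skew (insert x S) S"
  have fin: "finite S" "finite (addable S)" "finite (removable S)"
    using S by (simp_all add: diagram_finite finite_addable finite_removable)
  have rem: "diagram (S - {y})" "finite (addable (S - {y}))" "y \<in> S" "y \<in> addable (S - {y})" "insert y (S - {y}) = S"
    if "y \<in> removable S" for y
  proof -
    show "diagram (S - {y})" "y \<in> S" using that by (auto simp: removable_def)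
    then show "finite (addable (S - {y}))" "y \<in> addable (S - {y})" "insert y (S - {y}) = S"
      using S by (simp_all add: finite_addable) (simp_all add: addable_def insert_absorb)
  qed
  have add: "diagram (insert x S)" "finite (removable (insert x S))" "x \<notin> S" "x \<in> removable (insert x S)" "insert x S - {x} = S"
    if "x \<in> addable S" for x
    using that S fin(1) by (auto simp: addable_def removable_def)
  have "(\<Sum>x\<in>addable S. ?d x S * ?B (insert x S)) =
      (\<Sum>x\<in>addable S. ?d x S * phi_skew (insert x S) S * ?B S +
        (\<Sum>y\<in>removable (insert x S) - {x}. ?d x S * phi_skew (insert x S) (insert x S - {y}) * ?B (insert x S - {y})))"
  proof (rule sum.cong[OF refl])
    fix x assume x: "x \<in> addable S"
    have "?B (insert x S) = (\<Sum>y\<in>removable (insert x S). phi_skew (insert x S) (insert x S - {y}) * ?B (insert x S - {y}))"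
      by (rule tableau_sum_remove) (use add[OF x] in auto)
    also have "\<dots> = phi_skew (insert x S) S * ?B S +
        (\<Sum>y\<in>removable (insert x S) - {x}. phi_skew (insert x S) (insert x S - {y}) * ?B (insert x S - {y}))"
      using sum.remove[OF add(2,4)[OF x], of "\<lambda>y. phi_skew (insert x S) (insert x S - {y}) * ?B (insert x S - {y})"]
      by (simp only: add(5)[OF x])
    finally show "?d x S * ?B (insert x S) = ?d x S * phi_skew (insert x S) S * ?B S +
        (\<Sum>y\<in>removable (insert x S) - {x}. ?d x S * phi_skew (insert x S) (insert x S - {y}) * ?B (insert x S - {y}))"
      by (simp only: distrib_left sum_distrib_left mult.assoc)
  qed
  also have "\<dots> = (\<Sum>x\<in>addable S. ?d x S * phi_skew (insert x S) S) * ?B S +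
      (\<Sum>x\<in>addable S. \<Sum>y\<in>removable (insert x S) - {x}.
        ?d x S * phi_skew (insert x S) (insert x S - {y}) * ?B (insert x S - {y}))"
    by (simp only: sum.distrib sum_distrib_right)
  also have "(\<Sum>x\<in>addable S. \<Sum>y\<in>removable (insert x S) - {x}.
        ?d x S * phi_skew (insert x S) (insert x S - {y}) * ?B (insert x S - {y})) =
      (\<Sum>(x, y)\<in>(SIGMA x:addable S. removable (insert x S) - {x}).
        ?d x S * phi_skew (insert x S) (insert x S - {y}) * ?B (insert x S - {y}))"
    using fin(2) add(2) by (intro sum.Sigma) auto
  also have "\<dots> = (\<Sum>(y, x)\<in>(SIGMA y:removable S. addable (S - {y}) - {y}).
        phi_skew S (S - {y}) * (?d x (S - {y}) * ?B (insert x (S - {y}))))"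
  proof (rule sum.reindex_bij_betw[OF skew_add_remove[OF S], THEN sym, THEN trans, THEN sym])
    show "(\<Sum>p\<in>(SIGMA x:addable S. removable (insert x S) - {x}).
        case prod.swap p of (y, x) \<Rightarrow> phi_skew S (S - {y}) * (?d x (S - {y}) * ?B (insert x (S - {y})))) =
      (\<Sum>(x, y)\<in>(SIGMA x:addable S. removable (insert x S) - {x}).
        ?d x S * phi_skew (insert x S) (insert x S - {y}) * ?B (insert x S - {y}))"
    proof (rule sum.cong[OF refl])
      fix p assume p: "p \<in> (SIGMA x:addable S. removable (insert x S) - {x})"
      obtain x y where xy: "p = (x, y)" by (cases p)
      have "prod.swap p \<in> (SIGMA y:removable S. addable (S - {y}) - {y})"
        using bij_betwE[OF skew_add_remove[OF S]] p by blast
      then have y: "y \<in> removable S" and x: "x \<in> addable (S - {y})" "x \<noteq> y" by (auto simp: xy)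
      have eq: "insert x S - {y} = insert x (S - {y})" using x by auto
      have "?d x S * phi_skew (insert x S) (insert x (S - {y})) = ?d x (S - {y}) * phi_skew S (S - {y})"
        using skew_commute[OF rem(1)[OF y] x(1) rem(4)[OF y] x(2)] by (simp only: rem(5)[OF y])
      then show "(case prod.swap p of (y, x) \<Rightarrow> phi_skew S (S - {y}) * (?d x (S - {y}) * ?B (insert x (S - {y})))) =
          (case p of (x, y) \<Rightarrow> ?d x S * phi_skew (insert x S) (insert x S - {y}) * ?B (insert x S - {y}))"
        by (simp add: xy eq mult_ac)
    qed
  qed
  also have "\<dots> = (\<Sum>y\<in>removable S. \<Sum>x\<in>addable (S - {y}) - {y}.
        phi_skew S (S - {y}) * (?d x (S - {y}) * ?B (insert x (S - {y}))))"
    using fin(3) rem(2) by (intro sum.Sigma[symmetric]) auto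
  also have "\<dots> = (\<Sum>y\<in>removable S. of_nat (card S) * ?c * (phi_skew S (S - {y}) * ?B (S - {y})) -
      psi_skew S (S - {y}) * phi_skew S (S - {y}) * ?B S)"
  proof (rule sum.cong[OF refl])
    fix y assume y: "y \<in> removable S"
    have card: "card (S - {y}) < card S" "card (S - {y}) + 1 = card S"
      using card_Diff1_less[OF fin(1) rem(3)[OF y]] card.remove[OF fin(1) rem(3)[OF y]] by simp_all
    \<comment> \<open>The induction hypothesis needs the term x = y; subtracting it again produces the removal part of the commutator.\<close>
    have "(\<Sum>x\<in>addable (S - {y}) - {y}. ?d x (S - {y}) * ?B (insert x (S - {y}))) =
        (\<Sum>x\<in>addable (S - {y}). ?d x (S - {y}) * ?B (insert x (S - {y}))) - psi_skew S (S - {y}) * ?B S"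
      using sum.remove[OF rem(2,4)[OF y], of "\<lambda>x. ?d x (S - {y}) * ?B (insert x (S - {y}))"]
      by (simp only: rem(5)[OF y] add_diff_cancel_left')
    also have "\<dots> = of_nat (card S) * ?c * ?B (S - {y}) - psi_skew S (S - {y}) * ?B S"
      unfolding less.hyps[OF card(1) rem(1)[OF y]] card(2) ..
    finally show "(\<Sum>x\<in>addable (S - {y}) - {y}. phi_skew S (S - {y}) * (?d x (S - {y}) * ?B (insert x (S - {y})))) =
        of_nat (card S) * ?c * (phi_skew S (S - {y}) * ?B (S - {y})) - psi_skew S (S - {y}) * phi_skew S (S - {y}) * ?B S"
      by (simp only: sum_distrib_left[symmetric] right_diff_distrib) (simp only: mult_ac)
  qed
  also have "\<dots> = of_nat (card S) * ?c * (\<Sum>y\<in>removable S. phi_skew S (S - {y}) * ?B (S - {y})) -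
      (\<Sum>y\<in>removable S. psi_skew S (S - {y}) * phi_skew S (S - {y})) * ?B S"
    by (simp only: sum_subtractf sum_distrib_left sum_distrib_right)
  also have "of_nat (card S) * ?c * (\<Sum>y\<in>removable S. phi_skew S (S - {y}) * ?B (S - {y})) = of_nat (card S) * ?c * ?B S"
  proof (cases "S = {}")
    case False
    then show ?thesis by (simp only: tableau_sum_remove[OF S False])
  qed simp
  finally show ?case
    unfolding skew_weight_commutator[OF S] of_nat_add of_nat_1
    by (simp only: distrib_right mult_1_left)
qed

section \<open>Summation over all shapes\<close>

definition diagrams :: "nat \<Rightarrow> cell set set" where
  "diagrams n = {S. diagram S \<and> card S = n}"

lemma diagram_subset_square:
  assumes S: "diagram S"
  shows "S \<subseteq> {1..card S} \<times> {1..card S}"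
proof clarify
  fix r c assume rc: "(r, c) \<in> S"
  have "(\<lambda>i. (i, c)) ` {1..r} \<subseteq> S" "Pair r ` {1..c} \<subseteq> S"
    using diagram_down[OF S rc] diagram_ge_1[OF S rc] by auto
  then have "card ((\<lambda>i. (i, c)) ` {1..r}) \<le> card S" "card (Pair r ` {1..c}) \<le> card S"
    using diagram_finite[OF S] by (simp_all add: card_mono)
  then show "r \<in> {1..card S} \<and> c \<in> {1..card S}"
    using diagram_ge_1[OF S rc] by (simp add: card_image inj_on_def)
qed

lemma finite_diagrams: "finite (diagrams n)"
  by (rule finite_subset[of _ "Pow ({1..n} \<times> {1..n})"])
    (use diagram_subset_square in \<open>auto simp: diagrams_def\<close>)

text \<open>Expanding \<open>A\<close> by its recursion and exchanging the sums lets \<open>D\<close> act on \<open>B\<close>.\<close>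
lemma sum_diagrams_Suc:
  "(\<Sum>S\<in>diagrams (Suc n). tableau_sum psi_skew S * tableau_sum phi_skew S) =
    of_nat (Suc n) * ((1 - tvar) / (1 - qvar)) * (\<Sum>S\<in>diagrams n. tableau_sum psi_skew S * tableau_sum phi_skew S)"
proof -
  let ?A = "tableau_sum psi_skew" and ?B = "tableau_sum phi_skew"
  have "(\<Sum>S\<in>diagrams (Suc n). ?A S * ?B S) =
      (\<Sum>S\<in>diagrams (Suc n). \<Sum>x\<in>removable S. psi_skew S (S - {x}) * ?A (S - {x}) * ?B S)"
  proof (rule sum.cong[OF refl])
    fix S assume "S \<in> diagrams (Suc n)"
    then have S: "diagram S" "S \<noteq> {}" by (auto simp: diagrams_def)
    show "?A S * ?B S = (\<Sum>x\<in>removable S. psi_skew S (S - {x}) * ?A (S - {x}) * ?B S)"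
      unfolding tableau_sum_remove[OF S, of psi_skew] sum_distrib_right ..
  qed
  also have "\<dots> = (\<Sum>(S, x)\<in>(SIGMA S:diagrams (Suc n). removable S). psi_skew S (S - {x}) * ?A (S - {x}) * ?B S)"
    by (intro sum.Sigma finite_diagrams) (auto simp: diagrams_def diagram_finite finite_removable)
  also have "\<dots> = (\<Sum>(S, x)\<in>(SIGMA S:diagrams n. addable S). psi_skew (insert x S) S * ?A S * ?B (insert x S))"
    by (rule sum.reindex_bij_witness[where i = "\<lambda>(S, x). (insert x S, x)" and j = "\<lambda>(S, x). (S - {x}, x)"])
      (auto simp: diagrams_def addable_def removable_def insert_absorb diagram_finite)
  also have "\<dots> = (\<Sum>S\<in>diagrams n. \<Sum>x\<in>addable S. psi_skew (insert x S) S * ?A S * ?B (insert x S))"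
    by (intro sum.Sigma[symmetric] finite_diagrams) (auto simp: diagrams_def finite_addable)
  also have "\<dots> = (\<Sum>S\<in>diagrams n. of_nat (Suc n) * ((1 - tvar) / (1 - qvar)) * (?A S * ?B S))"
  proof (rule sum.cong[OF refl])
    fix S assume "S \<in> diagrams n"
    then have S: "diagram S" "card S + 1 = Suc n" by (auto simp: diagrams_def)
    have "(\<Sum>x\<in>addable S. psi_skew (insert x S) S * ?A S * ?B (insert x S)) =
        ?A S * (\<Sum>x\<in>addable S. psi_skew (insert x S) S * ?B (insert x S))"
      by (simp only: sum_distrib_left mult_ac)
    also have "\<dots> = of_nat (Suc n) * ((1 - tvar) / (1 - qvar)) * (?A S * ?B S)"
      unfolding tableau_sum_phi_down[OF S(1)] S(2) by (simp only: mult_ac)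
    finally show "(\<Sum>x\<in>addable S. psi_skew (insert x S) S * ?A S * ?B (insert x S)) =
        of_nat (Suc n) * ((1 - tvar) / (1 - qvar)) * (?A S * ?B S)" .
  qed
  finally show ?thesis by (simp only: sum_distrib_left)
qed

lemma sum_diagrams:
  "(\<Sum>S\<in>diagrams n. tableau_sum psi_skew S * tableau_sum phi_skew S) =
    ((1 - tvar) / (1 - qvar)) ^ n * fact n"
proof (induction n)
  case 0
  have "diagrams 0 = {{}}"
    by (auto simp: diagrams_def diagram_empty dest: diagram_finite)
  then show ?case by (simp add: tableau_sum_empty)
next
  case (Suc n)
  show ?case unfolding sum_diagrams_Suc Suc.IH fact_Suc power_Suc by (simp only: mult_ac)
qed

lemma mem_young_diagram:
  "(r, c) \<in> young_diagram lam \<longleftrightarrow> 1 \<le> r \<and> r \<le> length lam \<and> 1 \<le> c \<and> c \<le> lam ! (r - 1)"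
  by (simp add: young_diagram_def)

lemma card_young_diagram: "finite (young_diagram lam)" "card (young_diagram lam) = sum_list lam"
proof -
  have eq: "young_diagram lam = (SIGMA r:{1..length lam}. {1..lam ! (r - 1)})"
    by (auto simp: young_diagram_def)
  show "finite (young_diagram lam)" unfolding eq by simp
  have "card (young_diagram lam) = (\<Sum>r = 1..length lam. lam ! (r - 1))"
    unfolding eq by simp
  also have "\<dots> = (\<Sum>i = 0..<length lam. lam ! i)"
    by (rule sum.reindex_bij_witness[of _ Suc "\<lambda>r. r - 1"]) auto
  finally show "card (young_diagram lam) = sum_list lam" by (simp add: sum_list_sum_nth)
qed

lemma diagram_young_diagram:
  assumes "sorted_wrt (\<ge>) lam"
  shows "diagram (young_diagram lam)"
  unfolding diagram_def
proof (intro conjI allI impI)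
  fix r c r' c' assume rc: "(r, c) \<in> young_diagram lam" and le: "1 \<le> r'" "r' \<le> r" "1 \<le> c'" "c' \<le> c"
  have "lam ! (r - 1) \<le> lam ! (r' - 1)"
  proof (cases "r' = r")
    case False
    then have "r' - 1 < r - 1" "r - 1 < length lam"
      using rc le by (auto simp: mem_young_diagram)
    then show ?thesis using assms by (simp add: sorted_wrt_iff_nth_less)
  qed simp
  then show "(r', c') \<in> young_diagram lam"
    using rc le by (simp add: mem_young_diagram)
qed (auto simp: mem_young_diagram card_young_diagram)

lemma row_len_young_diagram:
  "row_len (young_diagram lam) (Suc i) = (if i < length lam then lam ! i else 0)"
proof -
  have "{c. (Suc i, c) \<in> young_diagram lam} = (if i < length lam then {1..lam ! i} else {})"
    by (auto simp: mem_young_diagram)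
  then show ?thesis by (simp add: row_len_def)
qed

text \<open>The inverse lists the positive row lengths. The number of parts is recovered from the diagram as the
  number of nonempty rows.\<close>
lemma bij_betw_young_diagram: "bij_betw young_diagram (partitions_of n) (diagrams n)"
  unfolding bij_betw_def
proof
  have len: "length lam = card {i. 0 < row_len (young_diagram lam) (Suc i)}" if "lam \<in> partitions_of n" for lam
  proof -
    have "0 < lam ! i" if "i < length lam" for i
      using \<open>lam \<in> partitions_of n\<close> that by (simp add: partitions_of_def)
    then have "{i. 0 < row_len (young_diagram lam) (Suc i)} = {..<length lam}"
      by (auto simp: row_len_young_diagram split: if_splits)
    then show ?thesis by simp
  qed
  show "inj_on young_diagram (partitions_of n)"
  proof (rule inj_onI)
    fix lam mu assume p: "lam \<in> partitions_of n" "mu \<in> partitions_of n" and eq: "young_diagram lam = young_diagram mu"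
    have l: "length lam = length mu" using len p eq by metis
    show "lam = mu"
    proof (rule nth_equalityI[OF l])
      fix i assume "i < length lam"
      then show "lam ! i = mu ! i"
        using row_len_young_diagram[of lam i] row_len_young_diagram[of mu i] eq l by simp
    qed
  qed
  show "young_diagram ` partitions_of n = diagrams n"
  proof (intro equalityI subsetI)
    fix S assume "S \<in> young_diagram ` partitions_of n"
    then show "S \<in> diagrams n"
      by (auto simp: diagrams_def partitions_of_def diagram_young_diagram card_young_diagram)
  next
    fix S assume "S \<in> diagrams n"
    then have S: "diagram S" "card S = n" by (auto simp: diagrams_def)
    let ?m = "row_len S"
    define L where "L = card {i. 0 < ?m (Suc i)}"
    obtain N where N: "\<forall>i>N. ?m i = 0" using diagram_row_bound[OF S(1)] by blast
    have fin: "finite {i. 0 < ?m (Suc i)}"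
    proof (rule finite_subset)
      show "{i. 0 < ?m (Suc i)} \<subseteq> {..N}"
      proof
        fix i assume "i \<in> {i. 0 < ?m (Suc i)}"
        then have "\<not> N < Suc i" using N by auto
        then show "i \<in> {..N}" by simp
      qed
    qed simp
    have down: "{i. 0 < ?m (Suc i)} = {..<L}"
    proof -
      have closed: "i \<in> {i. 0 < ?m (Suc i)}" if "j \<in> {i. 0 < ?m (Suc i)}" "i \<le> j" for i j
        using row_len_antimono[OF S(1), of "Suc i" "Suc j"] that by simp
      have "{i. 0 < ?m (Suc i)} = {..<k}" if "k = (LEAST k. k \<notin> {i. 0 < ?m (Suc i)})" for k
      proof (intro equalityI subsetI)
        have ex: "\<exists>k. k \<notin> {i. 0 < ?m (Suc i)}" using N by (metis (mono_tags) lessI mem_Collect_eq less_irrefl)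
        fix i
        show "i \<in> {..<k}" if "i \<in> {i. 0 < ?m (Suc i)}"
          using LeastI_ex[OF ex] closed[OF that, of k] \<open>k = _\<close> by (meson lessThan_iff not_le)
      next
        fix i assume "i \<in> {..<k}"
        then show "i \<in> {i. 0 < ?m (Suc i)}" using not_less_Least \<open>k = _\<close> by (metis lessThan_iff)
      qed
      then show ?thesis unfolding L_def by (metis card_lessThan)
    qed
    define lam where "lam = map (\<lambda>i. ?m (Suc i)) [0..<L]"
    have len: "length lam = L" and nth: "\<And>i. i < L \<Longrightarrow> lam ! i = ?m (Suc i)" by (simp_all add: lam_def)
    have eq: "S = young_diagram lam"
    proof (rule set_eqI, clarify)
      fix r c
      show "(r, c) \<in> S \<longleftrightarrow> (r, c) \<in> young_diagram lam"
      proof (cases r)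
        case 0
        then show ?thesis using diagram_ge_1[OF S(1), of r c] by (auto simp: mem_young_diagram)
      next
        case (Suc i)
        have "0 < ?m (Suc i) \<longleftrightarrow> i < L" using down by blast
        then show ?thesis
          using nth[of i] by (auto simp: mem_young_diagram mem_diagram_iff[OF S(1)] len Suc)
      qed
    qed
    moreover have "lam \<in> partitions_of n"
      unfolding partitions_of_def
    proof (intro CollectI conjI)
      show "sorted_wrt (\<ge>) lam"
        using row_len_antimono[OF S(1)] by (simp add: sorted_wrt_iff_nth_less len nth)
      have "0 < ?m (Suc i)" if "i < L" for i using that down by blast
      then show "\<forall>x\<in>set lam. 0 < x" by (simp add: lam_def)
      show "sum_list lam = n" unfolding card_young_diagram(2)[symmetric] eq[symmetric] by (rule S(2))
    qed
    ultimately show "S \<in> young_diagram ` partitions_of n" by blast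
  qed
qed

theorem mainTheorem2:
  fixes n :: nat
  assumes "n > 0"
  shows "(1 - tvar) ^ n / (1 - qvar) ^ n * fact n =
    (\<Sum>lam \<in> partitions_of n.
      \<Sum>(P, Q) \<in> SYT (young_diagram lam) \<times> SYT (young_diagram lam).
        psi_tableau (young_diagram lam) P * phi_tableau (young_diagram lam) Q)"
proof -
  have "(\<Sum>(P, Q) \<in> SYT S \<times> SYT S. psi_tableau S P * phi_tableau S Q) =
      tableau_sum psi_skew S * tableau_sum phi_skew S" for S
    by (simp add: tableau_sum_def psi_tableau_def phi_tableau_def sum_product sum.cartesian_product)
  then have "(\<Sum>lam \<in> partitions_of n.
      \<Sum>(P, Q) \<in> SYT (young_diagram lam) \<times> SYT (young_diagram lam).
        psi_tableau (young_diagram lam) P * phi_tableau (young_diagram lam) Q) =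
      (\<Sum>lam\<in>partitions_of n. tableau_sum psi_skew (young_diagram lam) * tableau_sum phi_skew (young_diagram lam))"
    by simp
  also have "\<dots> = (\<Sum>S\<in>diagrams n. tableau_sum psi_skew S * tableau_sum phi_skew S)"
    by (rule sum.reindex_bij_betw[OF bij_betw_young_diagram])
  also have "\<dots> = (1 - tvar) ^ n / (1 - qvar) ^ n * fact n"
    by (simp only: sum_diagrams power_divide)
  finally show ?thesis ..
qed

end
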